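(* Suppose $\underline z_i=\underline z$ for all $i$. Let $S^*\subset\mathbb R^n\times\mathbb R^n$ be the set of all feasible pairs of search and choice behaviors, and take any $(v,d)\in S^*$ with $v_1\ge v_2\ge\cdots\ge v_n$. Then $(v,d)$ is a vertex of $S^*$ if and only if, for some $i\in\{1,\dots,n\}$ and some $j\le i$, for each $k\in\{1,\dots,n\}$, $$v_k=\begin{cases}\overline v_k&\text{if }k\le i,\\0&\text{otherwise,}\end{cases}\qquad d_k=\begin{cases}\overline v_k-\overline v_{k+1}&\text{if }k\le i\text{ and }k\ne j,\\ \overline v_k-\overline v_{k+1}+p_i\cdot\overline v_i&\text{if }k=j,\\0&\text{otherwise.}\end{cases}$$ Moreover, any vertex of $S^*$ is fully implementable.
   Context: Model. There are $n\ge2$ boxes and a risk-neutral agent, Pandora. Box $i$ contains a reward $x_i\in\{\underline x_i,\overline x_i\}$, $0\le\underline x_i<\overline x_i\le1$, with prior probability $\lambda_i\in(0,1)$ of $\overline x_i$ and prior mean $\mu_i=\lambda_i\overline x_i+(1-\lambda_i)\underline x_i$. Opening box $i$ costs $c_i>0$, where $c_i<\lambda_i(\overline x_i-\underline x_i)$. A CDF $F_i$ on $[\underline x_i,\overline x_i]$ is feasible for box $i$ iff it has mean $\mu_i$; a CDF profile $F=(F_1,\dots,F_n)$ is feasible iff every $F_i$ is. Given $F$, the values $y_i\sim F_i$ are independent across boxes; opening box $i$ (possible at most once) costs $c_i$ and reveals $y_i$. A strategy is a (possibly mixed) sequential decision rule which, at each stage and depending on what has been observed, decides whether to stop and, if not,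 which unopened box to open next; at least one box must be opened (no outside option), and on stopping Pandora chooses one previously opened box. Her payoff is the value of the chosen box minus the total cost of the boxes opened; a strategy is optimal if it maximizes expected payoff. (With reservation values $z_i$ solving $c_i=\int_{z_i}^{\overline x_i}(y-z_i)dF_i(y)$, optimal strategies are those that open unopened boxes in decreasing order of reservation value, stop when the maximal observed value exceeds all reservation values of unopened boxes, and then choose the opened box with highest value; ties broken arbitrarily.) The search behavior $v\in\mathbb R^n$ lists the probabilities $v_i$ that box $i$ is opened; the choice behavior $d\in\mathbb R^n$ lists the probabilities $d_i$ that box $i$ is eventually chosen. A pair $(v,d)$ is feasible if some feasible CDF profile together with some optimal (possibly mixed) strategy under it induces it. A pair $(v,d)$ is fully implementable if for every $\delta>0$ there is a feasible CDF profile $F$ such that for every optimal strategy under $F$ the induced pair $(v',d')$ satisfies $\max_i|v_i-v_i'|<\delta$ and $\max_i|d_i-d_i'|<\delta$. Notation. $\underline z_i=\mu_i-c_i$, $\underline z=\max_i\underline z_i$, $p_i=1-\frac{c_i}{\overline x_i-\underline z}$, $\overline v_k=\prod_{l<k}p_l$ for $k=1,\dots,n+1$ (empty product equals 1). A point $s\in S$ is a vertex of $S\subset\mathbb R^N$ if some linear functional is uniquely maximized over $S$ at $s$. *)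

theory Defs
  imports "HOL-Probability.Probability"
begin

text \<open>
  Boxes are the elements of a finite linearly ordered type \<open>'n\<close>, which plays the role of
  \<open>{1, \<dots>, n}\<close> with \<open>n = CARD('n)\<close>.  A box problem is given by functions \<open>lo\<close>, \<open>hi\<close> (the two
  possible rewards), \<open>lam\<close> (prior probability of the high reward) and \<open>c\<close> (opening cost).
  A CDF is represented by the Borel probability measure it determines.
\<close>

definition prior_mean :: "('n \<Rightarrow> real) \<Rightarrow> ('n \<Rightarrow> real) \<Rightarrow> ('n \<Rightarrow> real) \<Rightarrow> 'n \<Rightarrow> real" where
  "prior_mean lo hi lam i = lam i * hi i + (1 - lam i) * lo i"

definition feasible_profile ::
  "('n \<Rightarrow> real) \<Rightarrow> ('n \<Rightarrow> real) \<Rightarrow> ('n \<Rightarrow> real) \<Rightarrow> ('n \<Rightarrow> real measure) \<Rightarrow> bool" where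
  "feasible_profile lo hi lam F \<longleftrightarrow>
     (\<forall>i. real_distribution (F i) \<and> (AE y in F i. lo i \<le> y \<and> y \<le> hi i) \<and>
          (\<integral>y. y \<partial>F i) = prior_mean lo hi lam i)"

text \<open>\<open>Choose i\<close> means: stop the search and take the value of box \<open>i\<close>.\<close>

datatype 'n action = Open 'n | Choose 'n

text \<open>
  A strategy maps the history, i.e. the list of opened boxes together with their revealed values
  in order of opening, to a lottery over the next action.
\<close>

type_synonym 'n strategy = "('n \<times> real) list \<Rightarrow> 'n action pmf"

definition history :: "('n \<Rightarrow> real) \<Rightarrow> 'n list \<Rightarrow> ('n \<times> real) list" where
  "history y bs = map (\<lambda>i. (i, y i)) bs"

text \<open>
  Each box is opened at most once and only opened boxes can be chosen; as nothing can be chosen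
  at the empty history, at least one box is opened.
\<close>

definition strategy :: "'n::finite strategy \<Rightarrow> bool" where
  "strategy s \<longleftrightarrow>
     (\<forall>y bs. distinct bs \<longrightarrow>
        set_pmf (s (history y bs)) \<subseteq> Open ` (- set bs) \<union> Choose ` set bs) \<and>
     (\<forall>bs a. distinct bs \<longrightarrow>
        (\<lambda>y. pmf (s (history y bs)) a) \<in> borel_measurable (Pi\<^sub>M UNIV (\<lambda>_. borel)))"

text \<open>
  \<open>play m s y bs\<close> is the distribution of (list of opened boxes, chosen box) when the values are
  \<open>y\<close>, the boxes \<open>bs\<close> have been opened so far, and at most \<open>m\<close> more actions are taken.  A strategy
  takes at most \<open>CARD('n) + 1\<close> actions, so the \<open>undefined\<close> case is never reached in \<open>outcome\<close>.
\<close>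

primrec play :: "nat \<Rightarrow> 'n strategy \<Rightarrow> ('n \<Rightarrow> real) \<Rightarrow> 'n list \<Rightarrow> ('n list \<times> 'n) pmf" where
  "play 0 s y bs = return_pmf (bs, undefined)"
| "play (Suc m) s y bs =
     bind_pmf (s (history y bs))
       (\<lambda>a. case a of Open i \<Rightarrow> play m s y (bs @ [i]) | Choose i \<Rightarrow> return_pmf (bs, i))"

definition outcome :: "'n::finite strategy \<Rightarrow> ('n \<Rightarrow> real) \<Rightarrow> ('n list \<times> 'n) pmf" where
  "outcome s y = play (Suc CARD('n)) s y []"

definition expected_payoff ::
  "('n::finite \<Rightarrow> real) \<Rightarrow> ('n \<Rightarrow> real measure) \<Rightarrow> 'n strategy \<Rightarrow> real" where
  "expected_payoff c F s =
     (\<integral>y. measure_pmf.expectation (outcome s y) (\<lambda>(bs, j). y j - (\<Sum>i\<in>set bs. c i))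
        \<partial>Pi\<^sub>M UNIV F)"

definition optimal ::
  "('n::finite \<Rightarrow> real) \<Rightarrow> ('n \<Rightarrow> real measure) \<Rightarrow> 'n strategy \<Rightarrow> bool" where
  "optimal c F s \<longleftrightarrow>
     strategy s \<and> (\<forall>s'. strategy s' \<longrightarrow> expected_payoff c F s' \<le> expected_payoff c F s)"

definition search_behavior :: "('n::finite \<Rightarrow> real measure) \<Rightarrow> 'n strategy \<Rightarrow> (real^'n)" where
  "search_behavior F s =
     (\<chi> i. \<integral>y. measure_pmf.prob (outcome s y) {(bs, j). i \<in> set bs} \<partial>Pi\<^sub>M UNIV F)"

definition choice_behavior :: "('n::finite \<Rightarrow> real measure) \<Rightarrow> 'n strategy \<Rightarrow> (real^'n)" where
  "choice_behavior F s =
     (\<chi> i. \<integral>y. measure_pmf.prob (outcome s y) {(bs, j). j = i} \<partial>Pi\<^sub>M UNIV F)"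

definition feasible_pairs ::
  "('n::finite \<Rightarrow> real) \<Rightarrow> ('n \<Rightarrow> real) \<Rightarrow> ('n \<Rightarrow> real) \<Rightarrow> ('n \<Rightarrow> real) \<Rightarrow>
   ((real^'n) \<times> (real^'n)) set" where
  "feasible_pairs lo hi lam c =
     {(search_behavior F s, choice_behavior F s) | F s.
        feasible_profile lo hi lam F \<and> optimal c F s}"

definition fully_implementable ::
  "('n::finite \<Rightarrow> real) \<Rightarrow> ('n \<Rightarrow> real) \<Rightarrow> ('n \<Rightarrow> real) \<Rightarrow> ('n \<Rightarrow> real) \<Rightarrow>
   (real^'n) \<times> (real^'n) \<Rightarrow> bool" where
  "fully_implementable lo hi lam c = (\<lambda>(v, d).
     \<forall>\<delta>>0. \<exists>F. feasible_profile lo hi lam F \<and>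
       (\<forall>s. optimal c F s \<longrightarrow>
          (\<forall>i. \<bar>v $ i - search_behavior F s $ i\<bar> < \<delta>) \<and>
          (\<forall>i. \<bar>d $ i - choice_behavior F s $ i\<bar> < \<delta>)))"

definition vertex_of :: "'a::real_vector \<Rightarrow> 'a set \<Rightarrow> bool" where
  "vertex_of s S \<longleftrightarrow>
     s \<in> S \<and> (\<exists>f :: 'a \<Rightarrow> real. linear f \<and> (\<forall>t\<in>S. t \<noteq> s \<longrightarrow> f t < f s))"

definition z_low ::
  "('n \<Rightarrow> real) \<Rightarrow> ('n \<Rightarrow> real) \<Rightarrow> ('n \<Rightarrow> real) \<Rightarrow> ('n \<Rightarrow> real) \<Rightarrow> 'n \<Rightarrow> real" where
  "z_low lo hi lam c i = prior_mean lo hi lam i - c i"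

definition z_max ::
  "('n::finite \<Rightarrow> real) \<Rightarrow> ('n \<Rightarrow> real) \<Rightarrow> ('n \<Rightarrow> real) \<Rightarrow> ('n \<Rightarrow> real) \<Rightarrow> real" where
  "z_max lo hi lam c = Max (range (z_low lo hi lam c))"

definition p_cont ::
  "('n::finite \<Rightarrow> real) \<Rightarrow> ('n \<Rightarrow> real) \<Rightarrow> ('n \<Rightarrow> real) \<Rightarrow> ('n \<Rightarrow> real) \<Rightarrow> 'n \<Rightarrow> real" where
  "p_cont lo hi lam c i = 1 - c i / (hi i - z_max lo hi lam c)"

text \<open>
  \<open>v_bar p k\<close> and \<open>v_bar_next p k\<close> are the products of \<open>p\<close> over the boxes before \<open>k\<close> and up to
  \<open>k\<close>, i.e. the terms with indices \<open>k\<close> and \<open>k + 1\<close> of the same sequence; the second constant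
  covers the index \<open>n + 1\<close>, which is not an element of \<open>'n\<close>.
\<close>

definition v_bar :: "('n::{finite,linorder} \<Rightarrow> real) \<Rightarrow> 'n \<Rightarrow> real" where
  "v_bar p k = (\<Prod>l<k. p l)"

definition v_bar_next :: "('n::{finite,linorder} \<Rightarrow> real) \<Rightarrow> 'n \<Rightarrow> real" where
  "v_bar_next p k = (\<Prod>l\<le>k. p l)"

end

theory Submission imports Defs
begin

text \<open>
  Let \<open>\<zeta> i\<close> be the reservation value of box \<open>i\<close>, so \<open>\<zeta> i \<ge> z\<close>.  Charging the excess of \<open>y i\<close> over
  \<open>\<zeta> i\<close> instead of the cost of an opened box shows that a strategy is optimal iff almost surely every
  opened box with \<open>y i > \<zeta> i\<close> is chosen and the chosen box maximizes \<open>min (y i) (\<zeta> i)\<close>.  Hence each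
  opening of \<open>i\<close> ends the search with probability at least \<open>c i / (hi i - \<zeta> i) \<ge> 1 - p i\<close>, and
  backward induction bounds every linear functional of the behavior by its value at one of the pairs
  \<open>point p L j\<close>: open the boxes of \<open>L\<close> in order, stop at \<open>x\<close> with probability \<open>1 - p x\<close>, and choose \<open>j\<close>
  at the end.  These pairs are feasible, as the laws on \<open>{z, hi i}\<close> make all boxes tie at \<open>z\<close>;
  each of them is exposed, by rewarding a stop at \<open>x\<close> the more the earlier \<open>x\<close> comes in \<open>L\<close>; and
  perturbing the laws to break the ties makes each of them fully implementable.
\<close>

section \<open>Play of a strategy\<close>

text \<open>Optimality quantifies over all mixed strategies and leaves ties open, so a rule for the
  order of opening would be awkward to extract from it. The amortized payoff leads instead to a
  condition on realized outcomes alone, which every optimal strategy satisfies almost surely. The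
  constant \<open>1 - p i\<close> comes from two estimates. The mean constraint gives E max 0 (y -
  z) \<ge> \<open>c i\<close>, hence \<open>\<zeta> i\<close> \<ge> z; and \<open>c i\<close> = E
  max 0 (y - \<open>\<zeta> i\<close>) is at most (\<open>hi i\<close> - \<open>\<zeta> i\<close>)
  P(y > \<open>\<zeta> i\<close>). Both are equalities for the law on {z, \<open>hi i\<close>}.
  Convexity of the feasible set is never proved: it contains the candidates and lies in their hull,
  and this sandwich already fixes its vertices. Full implementability has to control every optimal
  strategy under one profile. There only the chosen box is made almost surely unique up to a small
  event; the search frequencies are recovered from it, because opening \<open>i\<close> is
  independent of its value, and opening and choosing \<open>i\<close> coincide when
  \<open>y i\<close> exceeds \<open>\<zeta> i\<close>.\<close>

lemma strategyD:
  assumes "strategy s" "distinct bs"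
  shows "set_pmf (s (history y bs)) \<subseteq> Open ` (- set bs) \<union> Choose ` set bs"
    and "(\<lambda>y. pmf (s (history y bs)) a) \<in> borel_measurable (Pi\<^sub>M UNIV (\<lambda>_. borel))"
  using assms unfolding strategy_def by blast+

lemma history_cong: "(\<And>i. i \<in> set bs \<Longrightarrow> y i = y' i) \<Longrightarrow> history y bs = history y' bs"
  by (simp add: history_def)

lemma finite_set_pmf_play:
  assumes "strategy s"
  shows "distinct bs \<Longrightarrow> finite (set_pmf (play m s y bs))"
proof (induction m arbitrary: bs)
  case (Suc m)
  have sub: "set_pmf (s (history y bs)) \<subseteq> Open ` (- set bs) \<union> Choose ` set bs"
    using strategyD(1) assms Suc.prems by blast
  then have "finite (set_pmf (s (history y bs)))"
    by (rule finite_subset) simp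
  moreover have "finite (set_pmf (case a of Open i \<Rightarrow> play m s y (bs @ [i]) | Choose i \<Rightarrow> return_pmf (bs, i)))"
    if "a \<in> set_pmf (s (history y bs))" for a
    using that sub Suc by (cases a) auto
  ultimately show ?case by simp
qed simp

lemma play_step:
  assumes "strategy s" "distinct bs"
  shows "measure_pmf.expectation (play (Suc m) s y bs) h =
    (\<Sum>i\<in>- set bs. pmf (s (history y bs)) (Open i) * measure_pmf.expectation (play m s y (bs @ [i])) h) +
    (\<Sum>j\<in>set bs. pmf (s (history y bs)) (Choose j) * (h (bs, j) :: real))"
proof -
  let ?f = "\<lambda>a. case a of Open i \<Rightarrow> play m s y (bs @ [i]) | Choose i \<Rightarrow> return_pmf (bs, i)"
  have "measure_pmf.expectation (play (Suc m) s y bs) h =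
      (\<Sum>a\<in>Open ` (- set bs) \<union> Choose ` set bs.
         pmf (s (history y bs)) a *\<^sub>R measure_pmf.expectation (?f a) h)"
    unfolding play.simps
    by (rule pmf_expectation_bind)
       (use assms finite_set_pmf_play[OF assms(1)] strategyD(1)[OF assms] in \<open>auto split: action.split\<close>)
  also have "\<dots> = (\<Sum>i\<in>- set bs. pmf (s (history y bs)) (Open i) * measure_pmf.expectation (play m s y (bs @ [i])) h) +
    (\<Sum>j\<in>set bs. pmf (s (history y bs)) (Choose j) * h (bs, j))"
    by (subst sum.union_disjoint) (auto simp: sum.reindex inj_on_def)
  finally show ?thesis .
qed

lemma sum_actions:
  assumes "strategy s" "distinct bs"
  shows "(\<Sum>i\<in>- set bs. pmf (s (history y bs)) (Open i)) + (\<Sum>j\<in>set bs. pmf (s (history y bs)) (Choose j)) = 1"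
  using play_step[OF assms, of 0 y "\<lambda>_. 1"] by simp

lemma set_pmf_play_Suc:
  assumes "strategy s" "distinct bs" "x \<in> set_pmf (play (Suc m) s y bs)"
  obtains i where "i \<notin> set bs" "Open i \<in> set_pmf (s (history y bs))" "x \<in> set_pmf (play m s y (bs @ [i]))"
    | j where "j \<in> set bs" "Choose j \<in> set_pmf (s (history y bs))" "x = (bs, j)"
proof -
  from assms(3) obtain a where a: "a \<in> set_pmf (s (history y bs))"
    "x \<in> set_pmf (case a of Open i \<Rightarrow> play m s y (bs @ [i]) | Choose i \<Rightarrow> return_pmf (bs, i))"
    by auto
  show thesis
    using a strategyD(1)[OF assms(1,2), of y] that by (cases a) auto
qed

lemma play_mono:
  assumes "strategy s"
  shows "distinct bs \<Longrightarrow> (bs', j) \<in> set_pmf (play m s y bs) \<Longrightarrow> set bs \<subseteq> set bs'"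
proof (induction m arbitrary: bs)
  case (Suc m)
  from assms Suc.prems show ?case
  proof (cases rule: set_pmf_play_Suc)
    case (1 i)
    then show ?thesis using Suc.IH[of "bs @ [i]"] Suc.prems(1) by auto
  qed simp
qed simp

text \<open>The hypothesis on \<open>m\<close> keeps the action count from running out: at
  \<open>m = 0\<close> a distinct list would have more than \<open>CARD('n)\<close> entries, so the
  branch with \<open>undefined\<close> cannot occur.\<close>

lemma play_chosen:
  fixes s :: "'n::finite strategy"
  assumes "strategy s"
  shows "distinct bs \<Longrightarrow> CARD('n) < m + length bs \<Longrightarrow> (bs', j) \<in> set_pmf (play m s y bs) \<Longrightarrow> j \<in> set bs'"
proof (induction m arbitrary: bs)
  case 0
  then have "card (set bs) > CARD('n)" by (simp add: distinct_card)
  then show ?case using card_mono[of UNIV "set bs"] by simp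
next
  case (Suc m)
  from assms Suc.prems(1,3) show ?case
  proof (cases rule: set_pmf_play_Suc)
    case (1 i)
    then show ?thesis using Suc.IH[of "bs @ [i]"] Suc.prems(1,2) by auto
  qed simp
qed

lemma outcome_chosen:
  assumes "strategy s" "(bs, j) \<in> set_pmf (outcome s y)"
  shows "j \<in> set bs"
  using play_chosen[OF assms(1) _ _ assms(2)[unfolded outcome_def]] by simp

lemma finite_set_pmf_outcome: "strategy s \<Longrightarrow> finite (set_pmf (outcome s y))"
  unfolding outcome_def by (rule finite_set_pmf_play) simp_all

lemma integrable_outcome: "strategy s \<Longrightarrow> integrable (measure_pmf (outcome s y)) (h :: _ \<Rightarrow> real)"
  by (intro integrable_measure_pmf_finite finite_set_pmf_outcome)

lemma expectation_pmf_cong: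
  assumes "\<And>x. x \<in> set_pmf P \<Longrightarrow> h x = h' x"
  shows "measure_pmf.expectation P h = (measure_pmf.expectation P h' :: real)"
  by (rule integral_cong_AE) (use assms in \<open>auto simp: AE_measure_pmf_iff\<close>)

lemma play_opened:
  assumes "strategy s" "distinct bs" "i \<in> set bs"
  shows "measure_pmf.expectation (play m s y bs) (\<lambda>x. of_bool (i \<in> set (fst x))) = (1::real)"
proof -
  have "measure_pmf.expectation (play m s y bs) (\<lambda>x. of_bool (i \<in> set (fst x)))
      = measure_pmf.expectation (play m s y bs) (\<lambda>x. 1 :: real)"
    by (rule expectation_pmf_cong) (use play_mono[OF assms(1,2)] assms(3) in force)
  then show ?thesis by simp
qed

text \<open>Whether box \<open>i\<close> is opened is decided before its value is seen.\<close>

lemma play_nonanticipating: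
  assumes "strategy s"
  shows "distinct bs \<Longrightarrow> i \<notin> set bs \<Longrightarrow>
    measure_pmf.expectation (play m s (y(i := t)) bs) (\<lambda>x. of_bool (i \<in> set (fst x))) =
    (measure_pmf.expectation (play m s y bs) (\<lambda>x. of_bool (i \<in> set (fst x))) :: real)"
proof (induction m arbitrary: bs)
  case (Suc m)
  have h: "history (y(i := t)) bs = history y bs"
    by (rule history_cong) (use Suc.prems in auto)
  have "measure_pmf.expectation (play m s (y(i := t)) (bs @ [k])) (\<lambda>x. of_bool (i \<in> set (fst x))) =
    (measure_pmf.expectation (play m s y (bs @ [k])) (\<lambda>x. of_bool (i \<in> set (fst x))) :: real)"
    if "k \<in> - set bs" for k
  proof (cases "k = i")
    case True
    \<comment> \<open>Once \<open>i\<close> itself is opened both sides equal 1, however the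
      revealed value steers the rest of the play.\<close>
    then show ?thesis using play_opened[OF assms, of "bs @ [k]"] that Suc.prems by simp
  next
    case False
    then show ?thesis using Suc.IH[of "bs @ [k]"] that Suc.prems by (simp del: fun_upd_apply)
  qed
  then show ?case
    unfolding play_step[OF assms Suc.prems(1)] h by simp
qed simp

lemma measurable_play:
  fixes h :: "('n::finite \<Rightarrow> real) \<Rightarrow> 'n list \<times> 'n \<Rightarrow> real"
  assumes "strategy s"
    and h: "\<And>x. (\<lambda>y. h y x) \<in> borel_measurable (Pi\<^sub>M UNIV (\<lambda>_. borel))"
  shows "distinct bs \<Longrightarrow> (\<lambda>y. measure_pmf.expectation (play m s y bs) (h y))
    \<in> borel_measurable (Pi\<^sub>M UNIV (\<lambda>_. borel))"
proof (induction m arbitrary: bs)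
  case 0
  then show ?case using h by simp
next
  case (Suc m)
  show ?case
    unfolding play_step[OF assms(1) Suc.prems] using Suc.prems
    by (intro borel_measurable_add borel_measurable_sum borel_measurable_times
          strategyD(2)[OF assms(1)] Suc.IH h) auto
qed

lemma expectation_bound:
  assumes "finite (set_pmf P)" "\<And>x. x \<in> set_pmf P \<Longrightarrow> \<bar>h x\<bar> \<le> B"
  shows "\<bar>measure_pmf.expectation P h\<bar> \<le> (B :: real)"
proof -
  have "\<bar>measure_pmf.expectation P h\<bar> \<le> measure_pmf.expectation P (\<lambda>x. \<bar>h x\<bar>)"
    by simp
  also have "\<dots> \<le> measure_pmf.expectation P (\<lambda>x. B)"
    by (rule integral_mono_AE)
       (use assms in \<open>auto simp: AE_measure_pmf_iff intro: integrable_measure_pmf_finite\<close>)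
  finally show ?thesis by simp
qed

lemma measurable_outcome:
  fixes h :: "('n::finite \<Rightarrow> real) \<Rightarrow> 'n list \<times> 'n \<Rightarrow> real"
  assumes "strategy s"
    and h: "\<And>x. (\<lambda>y. h y x) \<in> borel_measurable (Pi\<^sub>M UNIV (\<lambda>_. borel))"
  shows "(\<lambda>y. measure_pmf.expectation (outcome s y) (h y)) \<in> borel_measurable (Pi\<^sub>M UNIV (\<lambda>_. borel))"
  unfolding outcome_def by (rule measurable_play[OF assms]) simp

section \<open>Reservation values and the optimality bound\<close>

text \<open>Reservation values are a parameter constrained by their equation, so laws built with a
  prescribed \<open>\<zeta>\<close> are direct instances; for an arbitrary feasible profile
  \<open>feasible_profile_boxes\<close> supplies \<open>\<zeta>\<close>.\<close>

locale boxes =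
  fixes F :: "'n::{finite,linorder} \<Rightarrow> real measure" and c \<zeta> :: "'n \<Rightarrow> real"
  assumes distribution: "\<And>i. real_distribution (F i)"
    and range: "\<And>i. AE y in F i. 0 \<le> y \<and> y \<le> 1"
    and cost_pos: "\<And>i. 0 < c i"
    and reservation: "\<And>i. (\<integral>y. max 0 (y - \<zeta> i) \<partial>F i) = c i"
begin

abbreviation M :: "('n \<Rightarrow> real) measure" where "M \<equiv> Pi\<^sub>M UNIV F"

lemma sets_F [measurable_cong]: "sets (F i) = sets borel"
  using distribution[of i] by (simp add: real_distribution_def real_distribution_axioms_def)

lemma prob_space_F: "prob_space (F i)"
  using distribution[of i] by (simp add: real_distribution_def)

sublocale finite_product_prob_space F UNIV
  by (intro finite_product_prob_space.intro product_prob_space.intro product_sigma_finite.intro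
        finite_product_sigma_finite.intro finite_product_sigma_finite_axioms.intro
        product_prob_space_axioms.intro prob_space_F prob_space_imp_sigma_finite)
     simp

lemma sets_M [measurable_cong]: "sets M = sets (Pi\<^sub>M UNIV (\<lambda>_. borel))"
  by (rule sets_PiM_cong) (simp_all add: sets_F)

lemma measurable_M:
  "f \<in> borel_measurable (Pi\<^sub>M UNIV (\<lambda>_. borel)) \<Longrightarrow> f \<in> borel_measurable M"
  by (simp cong: measurable_cong_sets add: sets_M)

lemma measurable_component_M [measurable]: "(\<lambda>y. y i) \<in> borel_measurable M"
  by (rule measurable_M) measurable

lemma AE_all_components:
  assumes "\<And>i. AE t in F i. P i t"
  shows "AE y in M. \<forall>i. P i (y i)"
proof -
  have "AE y in M. \<forall>i\<in>UNIV. P i (y i)"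
    by (rule AE_finite_allI) (use AE_component[OF _ assms] in auto)
  then show ?thesis by simp
qed

lemma AE_range: "AE y in M. \<forall>i. 0 \<le> y i \<and> y i \<le> 1"
  by (intro AE_all_components range)

lemma distr_component_M: "distr M (F i) (\<lambda>y. y i) = F i"
  by (rule PiM_component) simp

lemma integrable_component:
  assumes "integrable (F i) (\<psi> :: real \<Rightarrow> real)"
  shows "integrable M (\<lambda>y. \<psi> (y i))"
proof -
  have "integrable (distr M (F i) (\<lambda>y. y i)) \<psi>"
    using assms by (simp add: distr_component_M)
  then show ?thesis
    by (rule integrable_distr[rotated]) measurable
qed

text \<open>Independence in the form used throughout: a factor that ignores coordinate
  \<open>i\<close> separates from a function of \<open>y i\<close>, by Fubini after splitting
  \<open>UNIV\<close> as \<open>insert i (UNIV - {i})\<close>.\<close>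

lemma integral_mult_component:
  fixes \<phi> :: "('n \<Rightarrow> real) \<Rightarrow> real" and \<psi> :: "real \<Rightarrow> real"
  assumes \<phi>: "\<phi> \<in> borel_measurable (Pi\<^sub>M UNIV (\<lambda>_. borel))" "\<And>y. \<bar>\<phi> y\<bar> \<le> B"
    and const: "\<And>y t. \<phi> (y(i := t)) = \<phi> y"
    and \<psi>: "integrable (F i) \<psi>"
  shows "integrable M (\<lambda>y. \<phi> y * \<psi> (y i))"
    and "(\<integral>y. \<phi> y * \<psi> (y i) \<partial>M) = (\<integral>y. \<phi> y \<partial>M) * (\<integral>t. \<psi> t \<partial>F i)"
proof -
  have m: "\<phi> \<in> borel_measurable M" by (rule measurable_M) fact
  have int_\<phi>: "integrable M \<phi>"
    by (rule P.integrable_const_bound[of _ B]) (use \<phi> m in auto)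
  have int_\<psi>: "integrable M (\<lambda>y. \<psi> (y i))"
    by (rule integrable_component) fact
  show int: "integrable M (\<lambda>y. \<phi> y * \<psi> (y i))"
  proof (rule Bochner_Integration.integrable_bound)
    show "integrable M (\<lambda>y. B * \<bar>\<psi> (y i)\<bar>)" using int_\<psi> by simp
    show "(\<lambda>y. \<phi> y * \<psi> (y i)) \<in> borel_measurable M"
      using m int_\<psi> by (intro borel_measurable_times) auto
    have "B \<ge> 0" using \<phi>(2)[of undefined] by linarith
    then show "AE y in M. norm (\<phi> y * \<psi> (y i)) \<le> norm (B * \<bar>\<psi> (y i)\<bar>)"
      using \<phi>(2) by (auto simp: abs_mult intro!: mult_right_mono)
  qed
  have U: "insert i (UNIV - {i}) = UNIV" by auto
  note ins = product_integral_insert[of "UNIV - {i}" i, unfolded U]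
  have \<phi>0: "(\<integral>y. \<phi> y \<partial>M) = (\<integral>x. \<phi> x \<partial>Pi\<^sub>M (UNIV - {i}) F)"
    using prob_space.prob_space[OF prob_space_F[of i]] by (subst ins[OF _ _ int_\<phi>]) (simp_all add: const)
  show "(\<integral>y. \<phi> y * \<psi> (y i) \<partial>M) = (\<integral>y. \<phi> y \<partial>M) * (\<integral>t. \<psi> t \<partial>F i)"
    unfolding \<phi>0 by (subst ins[OF _ _ int]) (simp_all add: const)
qed

section \<open>Amortized values and the virtual payoff\<close>

definition cap :: "'n \<Rightarrow> ('n \<Rightarrow> real) \<Rightarrow> real" where
  "cap i y = min (y i) (\<zeta> i)"

definition excess :: "'n \<Rightarrow> ('n \<Rightarrow> real) \<Rightarrow> real" where
  "excess i y = max 0 (y i - \<zeta> i)"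

definition max_cap :: "('n \<Rightarrow> real) \<Rightarrow> real" where
  "max_cap y = Max ((\<lambda>i. cap i y) ` UNIV)"

text \<open>The payoff with the cost of each opened box replaced by its excess. The excess of the
  chosen box cuts its value down to \<open>cap\<close>, so only opened boxes that are not chosen
  remain in the sum.\<close>

definition virtual_payoff :: "('n \<Rightarrow> real) \<Rightarrow> 'n list \<times> 'n \<Rightarrow> real" where
  "virtual_payoff y x = cap (snd x) y - (\<Sum>i\<in>set (fst x) - {snd x}. excess i y)"

definition bound :: real where "bound = (\<Sum>i\<in>UNIV. 1 + \<bar>\<zeta> i\<bar>)"

lemma cap_le_max_cap: "cap i y \<le> max_cap y"
  by (simp add: max_cap_def)

lemma excess_nonneg: "0 \<le> excess i y"
  by (simp add: excess_def)

lemma excess_eq_0_iff: "excess i y = 0 \<longleftrightarrow> \<not> \<zeta> i < y i"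
  by (auto simp: excess_def)

lemma value_split: "y i = cap i y + excess i y"
  by (simp add: cap_def excess_def)

lemma measurable_cap [measurable]: "cap i \<in> borel_measurable (Pi\<^sub>M UNIV (\<lambda>_. borel))"
  unfolding cap_def by measurable

lemma measurable_excess [measurable]: "excess i \<in> borel_measurable (Pi\<^sub>M UNIV (\<lambda>_. borel))"
  unfolding excess_def by measurable

lemma measurable_max_cap [measurable]: "max_cap \<in> borel_measurable (Pi\<^sub>M UNIV (\<lambda>_. borel))"
  unfolding max_cap_def by (intro borel_measurable_Max) auto

lemma measurable_virtual_payoff: "(\<lambda>y. virtual_payoff y x) \<in> borel_measurable (Pi\<^sub>M UNIV (\<lambda>_. borel))"
  unfolding virtual_payoff_def by measurable

lemma single_le_bound: "1 + \<bar>\<zeta> i\<bar> \<le> bound"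
  unfolding bound_def by (rule member_le_sum) auto

lemma abs_cap_le:
  assumes "0 \<le> y i \<and> y i \<le> 1"
  shows "\<bar>cap i y\<bar> \<le> bound"
proof -
  have "\<bar>cap i y\<bar> \<le> 1 + \<bar>\<zeta> i\<bar>" using assms by (auto simp: cap_def min_def)
  with single_le_bound[of i] show ?thesis by linarith
qed

lemma abs_max_cap_le:
  assumes "\<forall>i. 0 \<le> y i \<and> y i \<le> 1"
  shows "\<bar>max_cap y\<bar> \<le> bound"
proof -
  have "max_cap y \<in> (\<lambda>i. cap i y) ` UNIV"
    unfolding max_cap_def by (rule Max_in) auto
  then show ?thesis using abs_cap_le assms by auto
qed

lemma abs_virtual_payoff_le:
  assumes "\<forall>i. 0 \<le> y i \<and> y i \<le> 1"
  shows "\<bar>virtual_payoff y x\<bar> \<le> 2 * bound"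
proof -
  have "(\<Sum>i\<in>set (fst x) - {snd x}. excess i y) \<le> (\<Sum>i\<in>UNIV. excess i y)"
    by (rule sum_mono2) (auto simp: excess_nonneg)
  also have "\<dots> \<le> bound"
    unfolding bound_def
  proof (rule sum_mono)
    fix i show "excess i y \<le> 1 + \<bar>\<zeta> i\<bar>"
      using spec[OF assms, of i] unfolding excess_def by linarith
  qed
  finally have "(\<Sum>i\<in>set (fst x) - {snd x}. excess i y) \<le> bound" .
  moreover have "0 \<le> (\<Sum>i\<in>set (fst x) - {snd x}. excess i y)"
    by (intro sum_nonneg excess_nonneg)
  moreover have "\<bar>cap (snd x) y\<bar> \<le> bound" by (rule abs_cap_le) (use assms in simp)
  ultimately show ?thesis unfolding virtual_payoff_def by linarith
qed

lemma integrable_max_cap: "integrable M max_cap"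
  by (rule P.integrable_const_bound[of _ bound])
     (use AE_range in \<open>auto intro: measurable_M abs_max_cap_le elim: AE_mp\<close>)

lemma integrable_expectation_outcome:
  fixes h :: "('n \<Rightarrow> real) \<Rightarrow> 'n list \<times> 'n \<Rightarrow> real"
  assumes "strategy s"
    and "\<And>x. (\<lambda>y. h y x) \<in> borel_measurable (Pi\<^sub>M UNIV (\<lambda>_. borel))"
    and "AE y in M. \<forall>x. \<bar>h y x\<bar> \<le> B"
  shows "integrable M (\<lambda>y. measure_pmf.expectation (outcome s y) (h y))"
proof (rule P.integrable_const_bound)
  show "AE y in M. norm (measure_pmf.expectation (outcome s y) (h y)) \<le> B"
    using assms(3) by eventually_elim
      (auto intro!: expectation_bound simp: finite_set_pmf_outcome[OF assms(1)])
  show "(\<lambda>y. measure_pmf.expectation (outcome s y) (h y)) \<in> borel_measurable M"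
    by (intro measurable_M measurable_outcome assms)
qed

lemma integrable_virtual_payoff:
  "strategy s \<Longrightarrow> integrable M (\<lambda>y. measure_pmf.expectation (outcome s y) (virtual_payoff y))"
  by (rule integrable_expectation_outcome[where B = "2 * bound"])
     (use AE_range in \<open>auto intro: measurable_virtual_payoff abs_virtual_payoff_le elim: AE_mp\<close>)

section \<open>Opening and choice probabilities conditional on the values\<close>

definition opens :: "'n strategy \<Rightarrow> 'n \<Rightarrow> ('n \<Rightarrow> real) \<Rightarrow> real" where
  "opens s i y = measure_pmf.expectation (outcome s y) (\<lambda>x. of_bool (i \<in> set (fst x)))"

definition chooses :: "'n strategy \<Rightarrow> 'n \<Rightarrow> ('n \<Rightarrow> real) \<Rightarrow> real" where
  "chooses s i y = measure_pmf.expectation (outcome s y) (\<lambda>x. of_bool (snd x = i))"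

lemma measurable_opens: "strategy s \<Longrightarrow> opens s i \<in> borel_measurable (Pi\<^sub>M UNIV (\<lambda>_. borel))"
  unfolding opens_def by (rule measurable_outcome) auto

lemma measurable_chooses: "strategy s \<Longrightarrow> chooses s i \<in> borel_measurable (Pi\<^sub>M UNIV (\<lambda>_. borel))"
  unfolding chooses_def by (rule measurable_outcome) auto

lemma opens_bound: "strategy s \<Longrightarrow> \<bar>opens s i y\<bar> \<le> 1"
  unfolding opens_def by (rule expectation_bound) (auto simp: finite_set_pmf_outcome)

lemma chooses_bound: "strategy s \<Longrightarrow> \<bar>chooses s i y\<bar> \<le> 1"
  unfolding chooses_def by (rule expectation_bound) (auto simp: finite_set_pmf_outcome)

lemma opens_upd: "strategy s \<Longrightarrow> opens s i (y(i := t)) = opens s i y"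
  unfolding opens_def outcome_def by (rule play_nonanticipating) auto

lemma search_behavior_eq: "search_behavior F s $ i = (\<integral>y. opens s i y \<partial>M)"
proof -
  have "measure_pmf.prob (outcome s y) {(bs, j). i \<in> set bs} = opens s i y" for y
  proof -
    have "opens s i y = measure_pmf.expectation (outcome s y) (indicator {(bs, j). i \<in> set bs})"
      unfolding opens_def by (rule Bochner_Integration.integral_cong) (auto simp: indicator_def)
    then show ?thesis by simp
  qed
  then show ?thesis by (simp add: search_behavior_def)
qed

lemma choice_behavior_eq: "choice_behavior F s $ i = (\<integral>y. chooses s i y \<partial>M)"
proof -
  have "measure_pmf.prob (outcome s y) {(bs, j). j = i} = chooses s i y" for y
  proof -
    have "chooses s i y = measure_pmf.expectation (outcome s y) (indicator {(bs, j). j = i})"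
      unfolding chooses_def by (rule Bochner_Integration.integral_cong) (auto simp: indicator_def)
    then show ?thesis by simp
  qed
  then show ?thesis by (simp add: choice_behavior_def)
qed

text \<open>A function that is not integrable has Bochner integral 0, whereas the reservation
  equation gives it the positive integral \<open>c i\<close>.\<close>

lemma integrable_excess: "integrable (F i) (\<lambda>t. max 0 (t - \<zeta> i))"
  using cost_pos[of i] reservation[of i] not_integrable_integral_eq[of "F i" "\<lambda>t. max 0 (t - \<zeta> i)"]
  by force

text \<open>The amortization of Kleinberg, Waggoner and Weyl: since opening box \<open>i\<close> is independent of its
  value, its cost may be replaced by the excess of its value over the reservation value.\<close>

lemma expected_payoff_eq:
  assumes s: "strategy s"
  shows "expected_payoff c F s =
    (\<integral>y. measure_pmf.expectation (outcome s y) (virtual_payoff y) \<partial>M)"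
proof -
  \<comment> \<open>Pathwise the two payoffs differ by excess minus cost, summed over the opened
    boxes; the chosen box is among them, so its excess turns \<open>cap j y\<close> back into
    \<open>y j\<close>.\<close>
  have *: "measure_pmf.expectation (outcome s y) (\<lambda>(bs, j). y j - (\<Sum>i\<in>set bs. c i)) =
      measure_pmf.expectation (outcome s y) (virtual_payoff y) +
      (\<Sum>i\<in>UNIV. opens s i y * (max 0 (y i - \<zeta> i) - c i))" for y
  proof -
    have "measure_pmf.expectation (outcome s y) (\<lambda>(bs, j). y j - (\<Sum>i\<in>set bs. c i)) =
      measure_pmf.expectation (outcome s y) (\<lambda>x. virtual_payoff y x +
        (\<Sum>i\<in>UNIV. of_bool (i \<in> set (fst x)) * (excess i y - c i)))"
    proof (rule expectation_pmf_cong, clarify)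
      fix bs j assume "(bs, j) \<in> set_pmf (outcome s y)"
      then have "j \<in> set bs" by (rule outcome_chosen[OF s])
      then have "(\<Sum>i\<in>set bs. excess i y) = excess j y + (\<Sum>i\<in>set bs - {j}. excess i y)"
        by (subst sum.remove) auto
      moreover have "(\<Sum>i\<in>UNIV. of_bool (i \<in> set bs) * (excess i y - c i)) = (\<Sum>i\<in>set bs. excess i y - c i)"
        by (rule sum.mono_neutral_cong_right) auto
      ultimately show "y j - (\<Sum>i\<in>set bs. c i) = virtual_payoff y (bs, j) +
          (\<Sum>i\<in>UNIV. of_bool (i \<in> set (fst (bs, j))) * (excess i y - c i))"
        using value_split[of y j] by (simp add: virtual_payoff_def sum_subtractf)
    qed
    also have "\<dots> = measure_pmf.expectation (outcome s y) (virtual_payoff y) +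
      (\<Sum>i\<in>UNIV. opens s i y * (max 0 (y i - \<zeta> i) - c i))"
      by (simp add: integrable_outcome[OF s] opens_def excess_def
          del: sum_of_bool_mult_eq sum_mult_of_bool_eq)
    finally show ?thesis .
  qed
  have int: "integrable (F i) (\<lambda>t. max 0 (t - \<zeta> i) - c i)" for i
    using integrable_excess by simp
  have "(\<integral>t. max 0 (t - \<zeta> i) - c i \<partial>F i) = 0" for i
    using integrable_excess[of i] reservation[of i] prob_space.prob_space[OF prob_space_F[of i]] by simp
  then have "integrable M (\<lambda>y. opens s i y * (max 0 (y i - \<zeta> i) - c i))"
     "(\<integral>y. opens s i y * (max 0 (y i - \<zeta> i) - c i) \<partial>M) = 0" for i
    using integral_mult_component[OF measurable_opens[OF s] opens_bound[OF s] opens_upd[OF s] int]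
    by auto
  then show ?thesis
    unfolding expected_payoff_def * using integrable_virtual_payoff[OF s] by simp
qed

text \<open>Weitzman's rule read off the final outcome: it is the equality case of
  \<open>virtual_payoff_le\<close>. The order of opening does not occur in it.\<close>

definition weitzman_outcome :: "('n \<Rightarrow> real) \<Rightarrow> 'n list \<times> 'n \<Rightarrow> bool" where
  "weitzman_outcome y x \<longleftrightarrow>
    (\<forall>i\<in>set (fst x). \<zeta> i < y i \<longrightarrow> snd x = i) \<and> (\<forall>i. cap i y \<le> cap (snd x) y)"

lemma virtual_payoff_le: "virtual_payoff y x \<le> max_cap y"
  using cap_le_max_cap[of "snd x" y] sum_nonneg[of "set (fst x) - {snd x}" "\<lambda>i. excess i y"]
  by (simp add: virtual_payoff_def excess_nonneg)

lemma virtual_payoff_eq_iff: "virtual_payoff y x = max_cap y \<longleftrightarrow> weitzman_outcome y x"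
proof -
  have "virtual_payoff y x = max_cap y \<longleftrightarrow>
      cap (snd x) y = max_cap y \<and> (\<Sum>i\<in>set (fst x) - {snd x}. excess i y) = 0"
    using cap_le_max_cap[of "snd x" y] sum_nonneg[of "set (fst x) - {snd x}" "\<lambda>i. excess i y"]
    by (auto simp: virtual_payoff_def excess_nonneg)
  also have "cap (snd x) y = max_cap y \<longleftrightarrow> (\<forall>i. cap i y \<le> cap (snd x) y)"
    unfolding max_cap_def by (subst eq_commute, subst Max_eq_iff) auto
  also have "(\<Sum>i\<in>set (fst x) - {snd x}. excess i y) = 0 \<longleftrightarrow>
      (\<forall>i\<in>set (fst x). \<zeta> i < y i \<longrightarrow> snd x = i)"
    by (subst sum_nonneg_eq_0_iff) (auto simp: excess_nonneg excess_eq_0_iff)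
  finally show ?thesis by (auto simp: weitzman_outcome_def)
qed

text \<open>The gap to \<open>max_cap\<close> is nonnegative for every outcome, so its mean vanishes
  only if it vanishes for almost every \<open>y\<close> on the whole support of the play.\<close>

lemma
  assumes s: "strategy s"
  shows expected_payoff_le: "expected_payoff c F s \<le> (\<integral>y. max_cap y \<partial>M)"
    and expected_payoff_eq_iff: "expected_payoff c F s = (\<integral>y. max_cap y \<partial>M) \<longleftrightarrow>
      (AE y in M. \<forall>x\<in>set_pmf (outcome s y). weitzman_outcome y x)"
proof -
  let ?gap = "\<lambda>y. measure_pmf.expectation (outcome s y) (\<lambda>x. max_cap y - virtual_payoff y x)"
  have gap: "?gap y = max_cap y - measure_pmf.expectation (outcome s y) (virtual_payoff y)" for y
    by (simp add: integrable_outcome[OF s])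
  have gap_nonneg: "0 \<le> ?gap y" for y
    by (rule Bochner_Integration.integral_nonneg) (use virtual_payoff_le in simp)
  have int: "integrable M ?gap"
    unfolding gap using integrable_max_cap integrable_virtual_payoff[OF s] by simp
  have diff: "(\<integral>y. max_cap y \<partial>M) - expected_payoff c F s = (\<integral>y. ?gap y \<partial>M)"
    unfolding expected_payoff_eq[OF s] gap
    using integrable_max_cap integrable_virtual_payoff[OF s] by simp
  show "expected_payoff c F s \<le> (\<integral>y. max_cap y \<partial>M)"
    using Bochner_Integration.integral_nonneg[of M ?gap, OF gap_nonneg] diff by linarith
  have "expected_payoff c F s = (\<integral>y. max_cap y \<partial>M) \<longleftrightarrow> (\<integral>y. ?gap y \<partial>M) = 0"
    using diff by linarith
  also have "\<dots> \<longleftrightarrow> (AE y in M. ?gap y = 0)"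
    by (rule integral_nonneg_eq_0_iff_AE[OF int]) (use gap_nonneg in simp)
  also have "\<dots> \<longleftrightarrow> (AE y in M. \<forall>x\<in>set_pmf (outcome s y). weitzman_outcome y x)"
  proof (rule AE_cong)
    fix y
    have "?gap y = 0 \<longleftrightarrow> (AE x in measure_pmf (outcome s y). max_cap y - virtual_payoff y x = 0)"
      by (rule integral_nonneg_eq_0_iff_AE[OF integrable_outcome[OF s]]) (use virtual_payoff_le in simp)
    also have "\<dots> \<longleftrightarrow> (\<forall>x\<in>set_pmf (outcome s y). weitzman_outcome y x)"
      by (auto simp: AE_measure_pmf_iff virtual_payoff_eq_iff[symmetric])
    finally show "?gap y = 0 \<longleftrightarrow> (\<forall>x\<in>set_pmf (outcome s y). weitzman_outcome y x)" .
  qed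
  finally show "expected_payoff c F s = (\<integral>y. max_cap y \<partial>M) \<longleftrightarrow>
      (AE y in M. \<forall>x\<in>set_pmf (outcome s y). weitzman_outcome y x)" .
qed

end

section \<open>Optimal strategies\<close>

text \<open>Ties go to \<open>j\<close> whenever \<open>j\<close> is among the maximizers, which is
  how a strategy realizes the fallback box of a candidate vertex; \<open>Min\<close> makes the other
  ties deterministic.\<close>

definition best :: "'n::{finite,linorder} \<Rightarrow> 'n list \<Rightarrow> ('n \<Rightarrow> real) \<Rightarrow> 'n" where
  "best j bs y = (if j \<in> set bs \<and> (\<forall>k\<in>set bs. y k \<le> y j) then j
     else Min {i \<in> set bs. \<forall>k\<in>set bs. y k \<le> y i})"

text \<open>Weitzman's search along \<open>L\<close>. A nonempty history that is not a proper prefix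
  of \<open>L\<close> ends the search at once, so the rule is legal on every history.\<close>

definition list_strategy :: "('n::{finite,linorder} \<Rightarrow> real) \<Rightarrow> 'n list \<Rightarrow> 'n \<Rightarrow> 'n strategy" where
  "list_strategy \<zeta> L j h =
     (let bs = map fst h; y = (\<lambda>i. the (map_of h i)) in
      if bs \<noteq> [] \<and> (length L \<le> length bs \<or> take (length bs) L \<noteq> bs \<or>
                    (\<exists>k\<in>set bs. \<zeta> (L ! length bs) < y k))
      then return_pmf (Choose (best j bs y)) else return_pmf (Open (L ! length bs)))"

lemma best_cong: "(\<And>i. i \<in> set bs \<Longrightarrow> y i = y' i) \<Longrightarrow> best j bs y = best j bs y'"
  unfolding best_def by (auto intro!: arg_cong[of _ _ Min])

lemma
  assumes "bs \<noteq> []"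
  shows best_in: "best j bs y \<in> set bs" and best_ge: "k \<in> set bs \<Longrightarrow> y k \<le> y (best j bs y)"
proof -
  let ?A = "{i \<in> set bs. \<forall>k\<in>set bs. y k \<le> y i}"
  have "Max (y ` set bs) \<in> y ` set bs" using assms by (intro Max_in) auto
  then obtain i where "i \<in> set bs" "y i = Max (y ` set bs)" by auto
  then have "i \<in> ?A" by simp
  then have "Min ?A \<in> ?A" by (intro Min_in) auto
  then show "best j bs y \<in> set bs" "k \<in> set bs \<Longrightarrow> y k \<le> y (best j bs y)"
    by (auto simp: best_def)
qed

text \<open>Serves measurability: the right-hand side is a finite Boolean combination of comparisons
  \<open>y l \<le> y k\<close>.\<close>

lemma best_eq_iff:
  assumes "bs \<noteq> []"
  shows "best j bs y = k \<longleftrightarrow> k \<in> set bs \<and> (\<forall>l\<in>set bs. y l \<le> y k) \<and>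
    (if j \<in> set bs \<and> (\<forall>l\<in>set bs. y l \<le> y j) then k = j
     else \<forall>i\<in>set bs. (\<forall>l\<in>set bs. y l \<le> y i) \<longrightarrow> k \<le> i)" (is "?l \<longleftrightarrow> ?r")
proof
  assume l: ?l
  then show ?r
    using best_in[OF assms, of j y] best_ge[OF assms, of _ y j]
    by (auto simp: best_def split: if_splits)
next
  assume r: ?r
  show ?l
  proof (cases "j \<in> set bs \<and> (\<forall>l\<in>set bs. y l \<le> y j)")
    case False
    then have "Min {i \<in> set bs. \<forall>k\<in>set bs. y k \<le> y i} = k"
      using r by (intro Min_eqI) auto
    with False show ?thesis unfolding best_def by (simp only: if_False)
  qed (use r in \<open>simp add: best_def\<close>)
qed

lemma list_strategy_history:
  "list_strategy \<zeta> L j (history y bs) =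
     (if bs \<noteq> [] \<and> (length L \<le> length bs \<or> take (length bs) L \<noteq> bs \<or>
                    (\<exists>k\<in>set bs. \<zeta> (L ! length bs) < y k))
      then return_pmf (Choose (best j bs y)) else return_pmf (Open (L ! length bs)))"
proof -
  have m: "map_of (history y bs) i = Some (y i)" if "i \<in> set bs" for i
    using that by (induction bs) (auto simp: history_def)
  then have "best j bs (\<lambda>i. the (map_of (history y bs) i)) = best j bs y"
    by (intro best_cong) simp
  moreover have "map fst (history y bs) = bs"
    by (simp add: history_def comp_def)
  ultimately show ?thesis
    using m by (simp add: list_strategy_def Let_def)
qed

lemma strategy_list_strategy:
  assumes "distinct L" "L \<noteq> []"
  shows "strategy (list_strategy \<zeta> L j)"
  unfolding strategy_def
proof (intro conjI allI impI)
  fix y and bs :: "'a list" assume "distinct bs"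
  have "L ! length bs \<notin> set bs" if "length bs < length L" "take (length bs) L = bs"
  proof -
    have "distinct (take (Suc (length bs)) L)" using assms by simp
    then show ?thesis using that by (simp add: take_Suc_conv_app_nth)
  qed
  then show "set_pmf (list_strategy \<zeta> L j (history y bs)) \<subseteq> Open ` (- set bs) \<union> Choose ` set bs"
    using assms best_in[of bs j y] by (auto simp: list_strategy_history)
next
  fix bs :: "'a list" and a assume "distinct bs"
  show "(\<lambda>y. pmf (list_strategy \<zeta> L j (history y bs)) a) \<in> borel_measurable (Pi\<^sub>M UNIV (\<lambda>_. borel))"
  proof (cases "bs = []")
    case True
    then show ?thesis by (simp add: list_strategy_history)
  next
    case False
    \<comment> \<open>The chosen box depends on \<open>y\<close>; a finite sum over its possible
      values makes every summand visibly measurable.\<close>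
    have eq: "pmf (list_strategy \<zeta> L j (history y bs)) a =
        (if length L \<le> length bs \<or> take (length bs) L \<noteq> bs \<or> (\<exists>k\<in>set bs. \<zeta> (L ! length bs) < y k)
         then \<Sum>k\<in>set bs. of_bool (best j bs y = k) * of_bool (Choose k = a)
         else of_bool (Open (L ! length bs) = a))" for y
    proof -
      have "(\<Sum>k\<in>set bs. of_bool (best j bs y = k) * of_bool (Choose k = a)) =
          (\<Sum>k\<in>set bs. if best j bs y = k then of_bool (Choose k = a) else (0::real))"
        by (intro sum.cong) auto
      then show ?thesis
        using False best_in[OF False, of j y]
        by (simp add: list_strategy_history sum.delta indicator_def)
    qed
    let ?N = "Pi\<^sub>M UNIV (\<lambda>_. borel) :: ('a \<Rightarrow> real) measure"
    have le: "Measurable.pred ?N (\<lambda>y. y l \<le> y k)" for k l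
      unfolding pred_def by (intro borel_measurable_le measurable_component_singleton) auto
    have max: "Measurable.pred ?N (\<lambda>y. \<forall>l\<in>set bs. y l \<le> y k)" for k
      by (intro pred_intros_finite le) simp
    have "Measurable.pred ?N (\<lambda>y. best j bs y = k)" for k
      unfolding best_eq_iff[OF False] if_bool_eq_conj
      by (intro pred_intros_logic pred_intros_finite max le) simp_all
    then have best: "(\<lambda>y. of_bool (best j bs y = k) :: real) \<in> borel_measurable ?N" for k
      by (simp add: of_bool_def)
    have "Measurable.pred ?N (\<lambda>y. \<zeta> (L ! length bs) < y k)" for k
      unfolding pred_def by (intro borel_measurable_less measurable_component_singleton) auto
    then have stop: "Measurable.pred ?N (\<lambda>y. length L \<le> length bs \<or> take (length bs) L \<noteq> bs \<or>
        (\<exists>k\<in>set bs. \<zeta> (L ! length bs) < y k))"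
      by (intro pred_intros_logic pred_intros_finite) simp_all
    show ?thesis
      unfolding eq by (intro measurable_If borel_measurable_sum borel_measurable_times best
          borel_measurable_const stop[unfolded pred_def])
  qed
qed

text \<open>The induction carries the past of the stopping test: the last box was opened only
  because no earlier value exceeded its reservation value. For the empty prefix this is
  vacuous.\<close>

lemma list_strategy_play:
  fixes L :: "'n::{finite,linorder} list"
  assumes L: "distinct L" "L \<noteq> []"
  shows "L = bs @ N \<Longrightarrow> length N < m \<Longrightarrow> \<forall>i\<in>set (butlast bs). y i \<le> \<zeta> (last bs) \<Longrightarrow>
    x \<in> set_pmf (play m (list_strategy \<zeta> L j) y bs) \<Longrightarrow>
    \<exists>bs N. L = bs @ N \<and> bs \<noteq> [] \<and> x = (bs, best j bs y) \<and>
      (\<forall>i\<in>set (butlast bs). y i \<le> \<zeta> (last bs)) \<and>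
      (N \<noteq> [] \<longrightarrow> (\<exists>k\<in>set bs. \<zeta> (hd N) < y k))"
proof (induction m arbitrary: bs N)
  case (Suc m)
  let ?s = "list_strategy \<zeta> L j"
  show ?case
  proof (cases "bs \<noteq> [] \<and> (length L \<le> length bs \<or> take (length bs) L \<noteq> bs \<or>
                    (\<exists>k\<in>set bs. \<zeta> (L ! length bs) < y k))")
    case True
    then have "x = (bs, best j bs y)"
      using Suc.prems(4) by (simp add: list_strategy_history)
    moreover have "N \<noteq> [] \<longrightarrow> (\<exists>k\<in>set bs. \<zeta> (hd N) < y k)"
      using True Suc.prems(1) by (auto simp: hd_conv_nth nth_append)
    ultimately show ?thesis using Suc.prems(1,3) True by blast
  next
    case False
    then obtain a N' where N: "N = a # N'"
      using Suc.prems(1) L(2) by (cases N) auto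
    then have nth: "L ! length bs = a" using Suc.prems(1) by simp
    show ?thesis
    proof (rule Suc.IH)
      show "L = (bs @ [a]) @ N'" "length N' < m" using Suc.prems(1,2) N by auto
      show "x \<in> set_pmf (play m ?s y (bs @ [a]))"
        using Suc.prems(4) False nth by (simp add: list_strategy_history split: if_splits)
      show "\<forall>i\<in>set (butlast (bs @ [a])). y i \<le> \<zeta> (last (bs @ [a]))"
        using False nth Suc.prems(1) N by (cases "bs = []") (auto simp: not_less)
    qed
  qed
qed simp

lemma list_strategy_outcome:
  fixes L :: "'n::{finite,linorder} list"
  assumes L: "distinct L" "L \<noteq> []" and x: "x \<in> set_pmf (outcome (list_strategy \<zeta> L j) y)"
  obtains bs N where "L = bs @ N" "bs \<noteq> []" "x = (bs, best j bs y)"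
    "\<forall>i\<in>set (butlast bs). y i \<le> \<zeta> (last bs)"
    "N \<noteq> [] \<Longrightarrow> \<exists>k\<in>set bs. \<zeta> (hd N) < y k"
proof -
  have "length L < Suc CARD('n)"
    using card_mono[of UNIV "set L"] distinct_card[OF L(1)] by simp
  then show thesis
    using list_strategy_play[OF L, of "[]" L _ y \<zeta> x j] x that
    unfolding outcome_def by (force simp del: play.simps)
qed

context boxes begin

text \<open>\<open>rest\<close> handles boxes left out of \<open>L\<close>: their capped value is at
  most \<open>\<zeta> i\<close>, which every box of \<open>L\<close> already guarantees. It is met
  when \<open>L\<close> lists all boxes, and also when all reservation values are equal to
  \<open>z\<close> and no value lies below \<open>z\<close>.\<close>

lemma weitzman_list_strategy:
  assumes L: "distinct L" "L \<noteq> []" "sorted_wrt (\<lambda>a b. \<zeta> b \<le> \<zeta> a) L"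
    and rest: "\<And>i l. i \<notin> set L \<Longrightarrow> l \<in> set L \<Longrightarrow> \<zeta> i \<le> \<zeta> l \<and> \<zeta> i \<le> y l"
    and x: "x \<in> set_pmf (outcome (list_strategy \<zeta> L j) y)"
  shows "weitzman_outcome y x"
proof -
  from L(1,2) x obtain bs N where bs: "L = bs @ N" "bs \<noteq> []" "x = (bs, best j bs y)"
    "\<forall>i\<in>set (butlast bs). y i \<le> \<zeta> (last bs)"
    "N \<noteq> [] \<Longrightarrow> \<exists>k\<in>set bs. \<zeta> (hd N) < y k"
    by (rule list_strategy_outcome) blast
  define j' where "j' = best j bs y"
  note j' = best_in[OF bs(2), of j y, folded j'_def] best_ge[OF bs(2), of _ y j, folded j'_def]
  have split: "bs = butlast bs @ [last bs]" using bs(2) by simp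
  have sorted_bs: "sorted_wrt (\<lambda>a b. \<zeta> b \<le> \<zeta> a) (butlast bs @ [last bs])"
    using L(3) bs(1) split by (simp add: sorted_wrt_append)
  then have last_le: "\<zeta> (last bs) \<le> \<zeta> i" if "i \<in> set bs" for i
    using that by (subst (asm) split) (auto simp: sorted_wrt_append)
  \<comment> \<open>A value above the reservation value of the last box would have ended the search
    before it, so only \<open>last bs\<close> can exceed its own reservation value.\<close>
  have opened_cases: "i = last bs \<or> y i \<le> \<zeta> (last bs)" if "i \<in> set bs" for i
    using that bs(4) by (subst (asm) split) auto
  have N_le: "\<zeta> i \<le> \<zeta> l" if "i \<in> set N" "l \<in> set bs" for i l
    using that L(3) bs(1) by (auto simp: sorted_wrt_append)
  have i: "j' = i" if "i \<in> set bs" "\<zeta> i < y i" for i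
  proof -
    have "i = last bs" using opened_cases[of i] last_le[of i] that by auto
    moreover have "j' = last bs"
      using opened_cases[OF j'(1)] j'(2)[OF that(1)] that last_le[OF that(1)] by auto
    ultimately show ?thesis by simp
  qed
  have "cap k y \<le> cap j' y" for k
  proof (cases "k \<in> set bs")
    case True
    show ?thesis
    proof (cases "y j' \<le> \<zeta> j'")
      case False
      then have "j' = last bs" using opened_cases[OF j'(1)] last_le[OF j'(1)] by auto
      then show ?thesis using opened_cases[OF True] False by (auto simp: cap_def)
    qed (use j'(2)[OF True] in \<open>auto simp: cap_def\<close>)
  next
    case False
    have "\<zeta> k \<le> \<zeta> j' \<and> \<zeta> k \<le> y j'"
    proof (cases "k \<in> set N")
      case True
      then have "N \<noteq> []" by auto
      then obtain l where l: "l \<in> set bs" "\<zeta> (hd N) < y l" using bs(5) by blast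
      have "sorted_wrt (\<lambda>a b. \<zeta> b \<le> \<zeta> a) N" using L(3) bs(1) by (simp add: sorted_wrt_append)
      then have "\<zeta> k \<le> \<zeta> (hd N)" using True by (cases N) auto
      then show ?thesis using l j'(2)[OF l(1)] N_le[OF True j'(1)] by auto
    next
      case False
      with \<open>k \<notin> set bs\<close> show ?thesis using rest[of k j'] bs(1) j'(1) by auto
    qed
    then show ?thesis by (auto simp: cap_def)
  qed
  with i show ?thesis by (auto simp: weitzman_outcome_def bs(3) j'_def)
qed

text \<open>Weitzman's rule along all boxes, sorted by decreasing \<open>\<zeta>\<close>, attains
  the upper bound given by the mean of \<open>max_cap\<close>; optimality is therefore equality in
  that bound.\<close>

lemma optimal_iff:
  "optimal c F s \<longleftrightarrow> strategy s \<and> (AE y in M. \<forall>x\<in>set_pmf (outcome s y). weitzman_outcome y x)"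
proof -
  define L where "L = sort_key (\<lambda>i. - \<zeta> i) (sorted_list_of_set UNIV)"
  have L: "distinct L" "set L = UNIV" "L \<noteq> []"
    unfolding L_def by (auto simp flip: set_empty)
  have "sorted (map (\<lambda>i. - \<zeta> i) L)" unfolding L_def by simp
  then have sorted: "sorted_wrt (\<lambda>a b. \<zeta> b \<le> \<zeta> a) L" by (simp add: sorted_wrt_map)
  have strat: "strategy (list_strategy \<zeta> L j)" for j
    using L by (intro strategy_list_strategy)
  have "\<forall>x\<in>set_pmf (outcome (list_strategy \<zeta> L j) y). weitzman_outcome y x" for j y
    using weitzman_list_strategy[OF L(1,3) sorted] L(2) by blast
  then have "expected_payoff c F (list_strategy \<zeta> L j) = (\<integral>y. max_cap y \<partial>M)" for j
    by (subst expected_payoff_eq_iff[OF strat]) simp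
  then have "optimal c F s \<longleftrightarrow> strategy s \<and> expected_payoff c F s = (\<integral>y. max_cap y \<partial>M)"
    unfolding optimal_def using strat expected_payoff_le by (metis order.antisym)
  then show ?thesis using expected_payoff_eq_iff by blast
qed

end

section \<open>Forced stops\<close>

text \<open>Given the values, the probability that the search begins by opening the boxes of
  \<open>bs\<close> in this order.\<close>

definition reach :: "'n strategy \<Rightarrow> ('n \<Rightarrow> real) \<Rightarrow> 'n list \<Rightarrow> real" where
  "reach s y bs = (\<Prod>t<length bs. pmf (s (history y (take t bs))) (Open (bs ! t)))"

lemma reach_Nil [simp]: "reach s y [] = 1"
  by (simp add: reach_def)

lemma reach_snoc: "reach s y (bs @ [i]) = reach s y bs * pmf (s (history y bs)) (Open i)"
  by (simp add: reach_def nth_append)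

lemma reach_nonneg: "0 \<le> reach s y bs"
  by (simp add: reach_def prod_nonneg)

lemma reach_le_1: "reach s y bs \<le> 1"
  unfolding reach_def by (rule prod_le_1) (simp add: pmf_le_1)

lemma abs_reach_le_1: "\<bar>reach s y bs\<bar> \<le> 1"
  using reach_nonneg[of s y bs] reach_le_1[of s y bs] by simp

lemma measurable_reach:
  assumes "strategy s"
  shows "distinct bs \<Longrightarrow> (\<lambda>y. reach s y bs) \<in> borel_measurable (Pi\<^sub>M UNIV (\<lambda>_. borel))"
proof (induction bs rule: rev_induct)
  case (snoc i bs)
  then show ?case
    unfolding reach_snoc by (intro borel_measurable_times strategyD(2)[OF assms]) auto
qed simp

text \<open>Only the values of \<open>butlast bs\<close> enter the histories involved, since the
  last box is opened before its value is seen. This makes \<open>reach\<close> independent of that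
  value.\<close>

lemma reach_upd:
  assumes "i \<notin> set (butlast bs)"
  shows "reach s (y(i := t)) bs = reach s y bs"
proof -
  have "history (y(i := t)) (take k bs) = history y (take k bs)" if "k < length bs" for k
  proof (rule history_cong)
    fix l assume "l \<in> set (take k bs)"
    moreover have "set (take k bs) \<subseteq> set (butlast bs)"
      unfolding butlast_conv_take by (rule set_take_subset_set_take) (use that in simp)
    ultimately have "l \<in> set (butlast bs)" by auto
    then show "(y(i := t)) l = y l" using assms by auto
  qed
  then show ?thesis by (simp add: reach_def del: fun_upd_apply)
qed

lemma play_reach:
  "0 < reach s y bs \<Longrightarrow> x \<in> set_pmf (play m s y bs) \<Longrightarrow> x \<in> set_pmf (play (m + length bs) s y [])"
proof (induction bs arbitrary: m rule: rev_induct)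
  case (snoc i bs)
  have "0 < reach s y bs" "0 < pmf (s (history y bs)) (Open i)"
    using snoc.prems(1) reach_nonneg[of s y bs] pmf_nonneg[of "s (history y bs)" "Open i"]
    unfolding reach_snoc by (auto simp: zero_less_mult_iff)
  moreover from this(2) have "x \<in> set_pmf (play (Suc m) s y bs)"
    using snoc.prems(2) by (auto simp: set_pmf_iff intro!: bexI[of _ "Open i"])
  ultimately show ?case using snoc.IH[of "Suc m"] by simp
qed simp

text \<open>The value of the relaxed problem when \<open>a\<close> pays for opening and
  \<open>b\<close> for choosing; \<open>val_eq\<close> shows that it is a linear functional of the
  behavior.\<close>

primrec val :: "('n \<Rightarrow> real) \<Rightarrow> ('n \<Rightarrow> real) \<Rightarrow> ('n \<Rightarrow> real) \<Rightarrow> 'n \<Rightarrow> 'n list \<Rightarrow> real" where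
  "val p a b j [] = b j"
| "val p a b j (x # L) = a x + (1 - p x) * b x + p x * val p a b j L"

context boxes begin

definition hit :: "'n \<Rightarrow> real" where "hit i = measure (F i) {\<zeta> i<..}"

lemma integral_hot: 
  "integrable (F i) (\<lambda>t. of_bool (\<zeta> i < t) :: real)" "(\<integral>t. of_bool (\<zeta> i < t) \<partial>F i) = hit i"
proof -
  have space: "space (F i) = UNIV" using sets_eq_imp_space_eq[OF sets_F[of i]] by simp
  have eq: "(\<lambda>t. of_bool (\<zeta> i < t)) = (indicator {\<zeta> i<..} :: real \<Rightarrow> real)"
    by (auto simp: indicator_def)
  have "{\<zeta> i<..} \<in> sets (F i)" by (simp add: sets_F)
  then show "integrable (F i) (\<lambda>t. of_bool (\<zeta> i < t) :: real)" "(\<integral>t. of_bool (\<zeta> i < t) \<partial>F i) = hit i"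
    unfolding eq by (auto simp: hit_def space M.emeasure_eq_measure)
qed

text \<open>Without mass above \<open>\<zeta> i\<close> the expected excess would be 0 instead of
  \<open>c i\<close>.\<close>

lemma hit_pos: "0 < hit i"
proof -
  have sets: "{\<zeta> i<..} \<in> sets (F i)" by (simp add: sets_F)
  have "hit i \<noteq> 0"
  proof
    assume "hit i = 0"
    then have "AE t in F i. t \<notin> {\<zeta> i<..}"
      unfolding hit_def using sets by (simp add: M.prob_eq_0)
    then have "(\<integral>t. max 0 (t - \<zeta> i) \<partial>F i) = (\<integral>t. 0 \<partial>F i)"
      by (intro integral_cong_AE) (auto simp: sets_F cong: measurable_cong_sets)
    then show False using reservation[of i] cost_pos[of i] by simp
  qed
  moreover have "0 \<le> hit i" by (simp add: hit_def)
  ultimately show ?thesis by simp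
qed

text \<open>Unconditional probabilities on the tree of opening orders: \<open>flow\<close> of
  passing through \<open>bs\<close>, \<open>stop_flow\<close> of ending there with \<open>j\<close>
  chosen. \<open>total\<close> is the contribution of the plays through \<open>bs\<close> to the
  expectation of \<open>h\<close>.\<close>

definition flow :: "'n strategy \<Rightarrow> 'n list \<Rightarrow> real" where
  "flow s bs = (\<integral>y. reach s y bs \<partial>M)"

definition stop_flow :: "'n strategy \<Rightarrow> 'n list \<Rightarrow> 'n \<Rightarrow> real" where
  "stop_flow s bs j = (\<integral>y. reach s y bs * pmf (s (history y bs)) (Choose j) \<partial>M)"

definition total :: "'n strategy \<Rightarrow> nat \<Rightarrow> 'n list \<Rightarrow> ('n list \<times> 'n \<Rightarrow> real) \<Rightarrow> real" where
  "total s m bs h = (\<integral>y. reach s y bs * measure_pmf.expectation (play m s y bs) h \<partial>M)"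

lemma integrable_reach_stop:
  assumes "strategy s" "distinct bs"
  shows "integrable M (\<lambda>y. reach s y bs * pmf (s (history y bs)) a)"
proof (rule P.integrable_const_bound[where B = 1])
  show "AE y in M. norm (reach s y bs * pmf (s (history y bs)) a) \<le> 1"
    by (auto simp: reach_nonneg reach_le_1 pmf_le_1 mult_le_one)
  show "(\<lambda>y. reach s y bs * pmf (s (history y bs)) a) \<in> borel_measurable M"
    by (intro borel_measurable_times measurable_M measurable_reach strategyD(2) assms)
qed

lemma integrable_reach_play:
  assumes "strategy s" "distinct bs" "\<And>x. \<bar>h x\<bar> \<le> B"
  shows "integrable M (\<lambda>y. reach s y bs * measure_pmf.expectation (play m s y bs) h)"
proof (rule P.integrable_const_bound[where B = B])
  have "\<bar>reach s y bs * measure_pmf.expectation (play m s y bs) h\<bar> \<le> 1 * B" for y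
    unfolding abs_mult using assms
    by (intro mult_mono abs_reach_le_1 expectation_bound finite_set_pmf_play) auto
  then show "AE y in M. norm (reach s y bs * measure_pmf.expectation (play m s y bs) h) \<le> B"
    by simp
  show "(\<lambda>y. reach s y bs * measure_pmf.expectation (play m s y bs) h) \<in> borel_measurable M"
    by (intro borel_measurable_times measurable_M measurable_reach measurable_play assms) simp
qed

lemma flow_nonneg: "0 \<le> flow s bs"
  unfolding flow_def by (intro Bochner_Integration.integral_nonneg reach_nonneg)

lemma stop_flow_nonneg: "0 \<le> stop_flow s bs j"
  unfolding stop_flow_def
  by (intro Bochner_Integration.integral_nonneg mult_nonneg_nonneg reach_nonneg pmf_nonneg)

lemma total_Suc:
  assumes s: "strategy s" "distinct bs" and h: "\<And>x. \<bar>h x\<bar> \<le> B"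
  shows "total s (Suc m) bs h =
    (\<Sum>i\<in>- set bs. total s m (bs @ [i]) h) + (\<Sum>j\<in>set bs. stop_flow s bs j * h (bs, j))"
proof -
  have eq: "reach s y bs * measure_pmf.expectation (play (Suc m) s y bs) h =
      (\<Sum>i\<in>- set bs. reach s y (bs @ [i]) * measure_pmf.expectation (play m s y (bs @ [i])) h) +
      (\<Sum>j\<in>set bs. (reach s y bs * pmf (s (history y bs)) (Choose j)) * h (bs, j))" for y
    unfolding play_step[OF s] reach_snoc by (simp add: distrib_left sum_distrib_left mult_ac)
  have int1: "integrable M (\<lambda>y. reach s y (bs @ [i]) * measure_pmf.expectation (play m s y (bs @ [i])) h)"
    if "i \<in> - set bs" for i
    using that s by (intro integrable_reach_play[OF s(1) _ h]) auto
  have int2: "integrable M (\<lambda>y. reach s y bs * pmf (s (history y bs)) (Choose j) * h (bs, j))" for j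
    by (intro integrable_mult_left integrable_reach_stop s)
  show ?thesis
    unfolding total_def stop_flow_def eq
    using int1 int2 by (subst Bochner_Integration.integral_add) (auto simp: Bochner_Integration.integral_sum)
qed

text \<open>The recursion for \<open>total\<close> with constant reward 1: the mass at
  \<open>bs\<close> either opens another box or stops.\<close>

lemma flow_conservation:
  assumes s: "strategy s" "distinct bs"
  shows "flow s bs = (\<Sum>i\<in>- set bs. flow s (bs @ [i])) + (\<Sum>j\<in>set bs. stop_flow s bs j)"
  using total_Suc[OF s, of "\<lambda>_. 1" 1 0] by (simp add: total_def flow_def del: play.simps)

text \<open>If \<open>y i\<close> exceeds \<open>\<zeta> i\<close>, no further box \<open>k\<close> is opened: otherwise \<open>y k\<close> would exceed \<open>\<zeta> k\<close> with
  positive probability, and both \<open>i\<close> and \<open>k\<close> would have to be chosen.\<close>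

lemma forced_stop:
  assumes opt: "optimal c F s" and d: "distinct (bs @ [i])"
  shows "hit i * flow s (bs @ [i]) \<le> stop_flow s (bs @ [i]) i"
proof -
  let ?B = "bs @ [i]" and ?hot = "\<lambda>i y. of_bool (\<zeta> i < y i) :: real"
  have s: "strategy s" and AE: "AE y in M. \<forall>x\<in>set_pmf (outcome s y). weitzman_outcome y x"
    using opt by (simp_all add: optimal_iff)
  have hot_meas: "?hot i \<in> borel_measurable (Pi\<^sub>M UNIV (\<lambda>_. borel))" for i
    by measurable
  have chosen: "j = k" if B: "distinct B" and y: "\<forall>x\<in>set_pmf (outcome s y). weitzman_outcome y x" "0 < reach s y B"
    "(bs', j) \<in> set_pmf (play m s y B)" and k: "k \<in> set B" "\<zeta> k < y k" and m: "m + length B = Suc CARD('n)"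
    for B y bs' j k m
  proof -
    have "(bs', j) \<in> set_pmf (outcome s y)"
      using play_reach[OF y(2,3)] m by (simp add: outcome_def del: play.simps)
    moreover have "k \<in> set bs'" using play_mono[OF s B y(3)] k by auto
    ultimately show ?thesis using y(1) k by (force simp: weitzman_outcome_def)
  qed
  have len: "\<exists>m. m + length B = Suc CARD('n)" if "distinct B" for B :: "'n list"
    using card_mono[of UNIV "set B"] distinct_card[OF that]
    by (intro exI[of _ "Suc CARD('n) - length B"]) simp
  have no_open: "(\<integral>y. reach s y (?B @ [k]) * ?hot i y \<partial>M) = 0" if k: "k \<notin> set ?B" for k
  proof -
    let ?\<phi> = "\<lambda>y. reach s y (?B @ [k]) * ?hot i y"
    have dk: "distinct (?B @ [k])" using d k by auto
    have upd: "?\<phi> (y(k := t)) = ?\<phi> y" for y t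
    proof -
      have ne: "i \<noteq> k" and kB: "k \<notin> set (butlast (?B @ [k]))" using k by (auto simp only: butlast_snoc) auto
      then show ?thesis using reach_upd[OF kB, of s y t] by simp
    qed
    have "\<bar>?\<phi> y\<bar> \<le> 1" for y using abs_reach_le_1[of s y "?B @ [k]"] by auto
    \<comment> \<open>Opening \<open>k\<close> after \<open>i\<close> ignores \<open>y k\<close>, so
      the mass that opens \<open>k\<close> although \<open>y i\<close> exceeds
      \<open>\<zeta> i\<close> enters multiplied by \<open>hit k\<close>. Optimality makes the
      product 0, and \<open>hit k\<close> is positive.\<close>
    then have "(\<integral>y. ?\<phi> y * ?hot k y \<partial>M) = (\<integral>y. ?\<phi> y \<partial>M) * hit k"
      using integral_mult_component(2)[where \<phi> = ?\<phi>, OF _ _ upd integral_hot(1)[of k]] 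
        measurable_reach[OF s dk] hot_meas integral_hot(2)[of k] by auto
    moreover have "AE y in M. ?\<phi> y * ?hot k y = 0"
      using AE
    proof eventually_elim
      case (elim y)
      show ?case
      proof (rule ccontr)
        assume "\<not> ?thesis"
        then have r: "0 < reach s y (?B @ [k])" and hot: "\<zeta> i < y i" "\<zeta> k < y k"
          using reach_nonneg[of s y "?B @ [k]"] by (auto split: if_splits)
        obtain m where m: "m + length (?B @ [k]) = Suc CARD('n)" using len[OF dk] by blast
        obtain bs' j where "(bs', j) \<in> set_pmf (play m s y (?B @ [k]))"
          using set_pmf_not_empty by (metis ex_in_conv surj_pair)
        then have "j = i" "j = k"
          using chosen[OF dk elim r _ _ _ m] hot by auto
        then show False using k by simp
      qed
    qed
    then have "(\<integral>y. ?\<phi> y * ?hot k y \<partial>M) = 0"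
      by (rule integral_eq_zero_AE)
    ultimately show ?thesis using hit_pos[of k] by simp
  qed
  have no_other: "AE y in M. reach s y ?B * pmf (s (history y ?B)) (Choose j) * ?hot i y = 0"
    if j: "j \<in> set ?B" "j \<noteq> i" for j
    using AE
  proof eventually_elim
    case (elim y)
    show ?case
    proof (rule ccontr)
      assume *: "\<not> ?thesis"
      then have r: "0 < reach s y ?B" and hot: "\<zeta> i < y i"
        using reach_nonneg[of s y ?B] by (auto split: if_splits)
      obtain m where m: "Suc m + length ?B = Suc CARD('n)"
      proof -
        have "length ?B \<le> CARD('n)" using card_mono[of UNIV "set ?B"] distinct_card[OF d] by simp
        then show thesis using that[of "CARD('n) - length ?B"] by simp
      qed
      have "(?B, j) \<in> set_pmf (play (Suc m) s y ?B)"
        using * by (auto simp: set_pmf_iff intro!: bexI[of _ "Choose j"])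
      then have "j = i" using chosen[OF d elim r _ _ hot m] by simp
      then show False using j by simp
    qed
  qed
  have reach_meas: "(\<lambda>y. reach s y ?B) \<in> borel_measurable (Pi\<^sub>M UNIV (\<lambda>_. borel))"
    by (rule measurable_reach[OF s d])
  have int_open: "integrable M (\<lambda>y. reach s y (?B @ [k]) * ?hot i y)" if "k \<notin> set ?B" for k
    using that d hot_meas
    by (intro P.integrable_const_bound[where B = 1])
       (auto simp: reach_nonneg reach_le_1 abs_mult intro!: borel_measurable_times measurable_M measurable_reach[OF s])
  have int_stop: "integrable M (\<lambda>y. reach s y ?B * pmf (s (history y ?B)) (Choose j) * ?hot i y)" for j
    by (rule Bochner_Integration.integrable_bound[OF integrable_reach_stop[OF s d, of "Choose j"]])
       (use hot_meas in \<open>auto simp: abs_mult mult_le_cancel_left1 intro!: borel_measurable_times measurable_M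
          measurable_reach[OF s d] strategyD(2)[OF s d]\<close>)
  \<comment> \<open>\<open>i\<close> is the last box of \<open>?B\<close>, so reaching
    \<open>?B\<close> is independent of \<open>y i\<close>. The mass with \<open>y i\<close> above
    \<open>\<zeta> i\<close> is split over the next action, and only choosing \<open>i\<close>
    survives.\<close>
  have "hit i * flow s ?B = (\<integral>y. reach s y ?B * ?hot i y \<partial>M)"
    using integral_mult_component(2)[where \<phi> = "\<lambda>y. reach s y ?B", OF reach_meas abs_reach_le_1 _ integral_hot(1)]
      reach_upd[of i ?B s] d integral_hot(2)[of i] by (simp add: flow_def)
  also have "\<dots> = (\<integral>y. (\<Sum>k\<in>- set ?B. reach s y (?B @ [k]) * ?hot i y) +
      (\<Sum>j\<in>set ?B. reach s y ?B * pmf (s (history y ?B)) (Choose j) * ?hot i y) \<partial>M)"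
  proof (rule Bochner_Integration.integral_cong[OF refl])
    fix y
    have "reach s y ?B * ?hot i y = reach s y ?B * ?hot i y * 
      ((\<Sum>i\<in>- set ?B. pmf (s (history y ?B)) (Open i)) + (\<Sum>j\<in>set ?B. pmf (s (history y ?B)) (Choose j)))"
      by (simp only: sum_actions[OF s d] mult_1_right)
    also have "\<dots> = (\<Sum>k\<in>- set ?B. reach s y (?B @ [k]) * ?hot i y) +
      (\<Sum>j\<in>set ?B. reach s y ?B * pmf (s (history y ?B)) (Choose j) * ?hot i y)"
      unfolding reach_snoc[of s y ?B] by (simp only: distrib_left sum_distrib_left mult_ac)
    finally show "reach s y ?B * ?hot i y = \<dots>" .
  qed
  also have "\<dots> = (\<Sum>k\<in>- set ?B. \<integral>y. reach s y (?B @ [k]) * ?hot i y \<partial>M) +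
      (\<Sum>j\<in>set ?B. \<integral>y. reach s y ?B * pmf (s (history y ?B)) (Choose j) * ?hot i y \<partial>M)"
    using int_open int_stop
    by (subst Bochner_Integration.integral_add)
       (auto intro!: Bochner_Integration.integrable_sum simp: Bochner_Integration.integral_sum
         simp del: sum_mult_of_bool_eq sum_of_bool_mult_eq append_assoc)
  also have "\<dots> = (\<Sum>j\<in>set ?B. \<integral>y. reach s y ?B * pmf (s (history y ?B)) (Choose j) * ?hot i y \<partial>M)"
    using no_open by simp
  also have "\<dots> = (\<integral>y. reach s y ?B * pmf (s (history y ?B)) (Choose i) * ?hot i y \<partial>M)"
    using integral_eq_zero_AE[OF no_other]
    by (subst sum.remove[of _ i]) (auto intro!: sum.neutral)
  also have "\<dots> \<le> stop_flow s ?B i"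
    unfolding stop_flow_def
    by (rule integral_mono[OF int_stop integrable_reach_stop[OF s d]])
       (auto simp: reach_nonneg)
  finally show ?thesis .
qed

end

section \<open>Convex hull of the candidate vertices\<close>

text \<open>The vertices come from a relaxed problem: the boxes of \<open>L\<close> are opened in order, opening \<open>x\<close>
  ends the search with \<open>x\<close> chosen with probability \<open>1 - p x\<close>, and \<open>j\<close> is chosen if no box ends it.\<close>

primrec opened :: "('n \<Rightarrow> real) \<Rightarrow> 'n list \<Rightarrow> 'n \<Rightarrow> real" where
  "opened p [] k = 0"
| "opened p (x # L) k = (if k = x then 1 else p x * opened p L k)"

primrec chosen :: "('n \<Rightarrow> real) \<Rightarrow> 'n \<Rightarrow> 'n list \<Rightarrow> 'n \<Rightarrow> real" where
  "chosen p j [] k = of_bool (k = j)"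
| "chosen p j (x # L) k = (1 - p x) * of_bool (k = x) + p x * chosen p j L k"

lemma opened_notin: "k \<notin> set L \<Longrightarrow> opened p L k = 0"
  by (induction L) auto

text \<open>Identifies \<open>val\<close> with the functional \<open>(a, b)\<close> evaluated at
  \<open>point p L j\<close>; distinctness keeps the head from being counted again in the
  tail.\<close>

lemma val_eq:
  fixes a b :: "'n::finite \<Rightarrow> real"
  shows "distinct L \<Longrightarrow> val p a b j L = (\<Sum>k\<in>UNIV. a k * opened p L k) + (\<Sum>k\<in>UNIV. b k * chosen p j L k)"
proof (induction L)
  case (Cons x L)
  have "(\<Sum>k\<in>UNIV. a k * opened p (x # L) k) = (\<Sum>k\<in>UNIV. a k * of_bool (k = x) + p x * (a k * opened p L k))"
    using Cons.prems opened_notin[of x L p] by (intro sum.cong) auto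
  moreover have "(\<Sum>k\<in>UNIV. b k * chosen p j (x # L) k) =
      (\<Sum>k\<in>UNIV. (1 - p x) * (b k * of_bool (k = x)) + p x * (b k * chosen p j L k))"
    by (intro sum.cong) (auto simp: algebra_simps)
  ultimately show ?case
    using Cons by (simp add: sum.distrib sum_distrib_left[symmetric] distrib_left del: opened.simps chosen.simps)
qed simp

definition point :: "('n::finite \<Rightarrow> real) \<Rightarrow> 'n list \<Rightarrow> 'n \<Rightarrow> (real^'n) \<times> (real^'n)" where
  "point p L j = (\<chi> k. opened p L k, \<chi> k. chosen p j L k)"

definition points :: "('n::finite \<Rightarrow> real) \<Rightarrow> ((real^'n) \<times> (real^'n)) set" where
  "points p = {point p L j | L j. distinct L \<and> L \<noteq> [] \<and> j \<in> set L}"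

lemma finite_points: "finite (points (p :: 'n::finite \<Rightarrow> real))"
proof -
  have "finite {L :: 'n list. distinct L}"
    using finite_subset_distinct[of "UNIV :: 'n set"] by simp
  then have "finite ((\<lambda>(L, j). point p L j) ` ({L. distinct L} \<times> UNIV))"
    by (intro finite_imageI finite_cartesian_product) auto
  then show ?thesis
    by (rule rev_finite_subset) (force simp: points_def)
qed

context boxes begin

definition reward :: "('n \<Rightarrow> real) \<Rightarrow> ('n \<Rightarrow> real) \<Rightarrow> 'n list \<times> 'n \<Rightarrow> real" where
  "reward a b x = (\<Sum>i\<in>set (fst x). a i) + b (snd x)"

lemma abs_reward_le: "\<bar>reward a b x\<bar> \<le> (\<Sum>i\<in>UNIV. \<bar>a i\<bar>) + (\<Sum>i\<in>UNIV. \<bar>b i\<bar>)"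
proof -
  have "\<bar>\<Sum>i\<in>set (fst x). a i\<bar> \<le> (\<Sum>i\<in>set (fst x). \<bar>a i\<bar>)" by (rule sum_abs)
  also have "\<dots> \<le> (\<Sum>i\<in>UNIV. \<bar>a i\<bar>)" by (rule sum_mono2) auto
  finally have "\<bar>\<Sum>i\<in>set (fst x). a i\<bar> \<le> (\<Sum>i\<in>UNIV. \<bar>a i\<bar>)" .
  moreover have "\<bar>b (snd x)\<bar> \<le> (\<Sum>i\<in>UNIV. \<bar>b i\<bar>)" by (rule member_le_sum) auto
  ultimately show ?thesis unfolding reward_def by linarith
qed

text \<open>Backward induction: after \<open>i\<close> is opened, at least the share \<open>1 - p i\<close> of the flow stops there,
  and the rest is worth at most the best continuation.\<close>

lemma total_le:
  assumes opt: "optimal c F s" and p: "\<And>i. 0 \<le> p i" "\<And>i. 1 - p i \<le> hit i"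
  shows "distinct (bs @ [i]) \<Longrightarrow> m + length (bs @ [i]) = Suc CARD('n) \<Longrightarrow>
    \<exists>L j. distinct (bs @ i # L) \<and> j \<in> set (bs @ i # L) \<and>
      total s m (bs @ [i]) (reward a b) \<le> flow s (bs @ [i]) * ((\<Sum>k\<in>set bs. a k) + val p a b j (i # L))"
proof (induction m arbitrary: bs i)
  case 0
  then show ?case using card_mono[of UNIV "set (bs @ [i])"] distinct_card[of "bs @ [i]"] by simp
next
  case (Suc m)
  let ?B = "bs @ [i]"
  have s: "strategy s" using opt by (simp add: optimal_def)
  have "\<exists>L j. distinct (?B @ k # L) \<and> j \<in> set (?B @ k # L) \<and>
      total s m (?B @ [k]) (reward a b) \<le> flow s (?B @ [k]) * ((\<Sum>k\<in>set ?B. a k) + val p a b j (k # L))"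
    if "k \<in> - set ?B" for k
    using that Suc.prems by (intro Suc.IH) auto
  then obtain L j where Lj: "\<And>k. k \<in> - set ?B \<Longrightarrow> distinct (?B @ k # L k) \<and> j k \<in> set (?B @ k # L k) \<and>
      total s m (?B @ [k]) (reward a b) \<le> flow s (?B @ [k]) * ((\<Sum>k\<in>set ?B. a k) + val p a b (j k) (k # L k))"
    by metis
  \<comment> \<open>All continuations that compete after \<open>i\<close>: for each next box the
    witness of the induction hypothesis, and stopping now with any opened box. \<open>v\<close> is
    the best of their values.\<close>
  define C where "C = (\<lambda>k. (k # L k, j k)) ` (- set ?B) \<union> (\<lambda>j. ([], j)) ` set ?B"
  define v where "v = Max ((\<lambda>(L, j). val p a b j L) ` C)"
  have C: "finite C" "C \<noteq> {}" by (auto simp: C_def)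
  have le: "val p a b j L \<le> v" if "(L, j) \<in> C" for L j
    unfolding v_def using C that by (intro Max_ge) force+
  have "v \<in> (\<lambda>(L, j). val p a b j L) ` C"
    unfolding v_def using C by (intro Max_in) auto
  then obtain L' j' where L': "(L', j') \<in> C" "val p a b j' L' = v" by force
  have valid: "distinct (?B @ L') \<and> j' \<in> set (?B @ L')"
  proof -
    from L'(1) consider k where "k \<in> - set ?B" "L' = k # L k" "j' = j k" | "L' = []" "j' \<in> set ?B"
      unfolding C_def by blast
    then show ?thesis
    proof cases
      case (1 k)
      show ?thesis unfolding 1(2,3) using Lj[OF 1(1)] by blast
    next
      case 2
      then show ?thesis using Suc.prems(1) by simp
    qed
  qed
  define A where "A = (\<Sum>k\<in>set ?B. a k)"
  let ?w = "flow s ?B" and ?x = "stop_flow s ?B"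
  have forced: "(1 - p i) * ?w \<le> ?x i"
    using forced_stop[OF opt Suc.prems(1)] mult_right_mono[OF p(2)[of i] flow_nonneg[of s ?B]] by linarith
  have "reward a b (?B, j) = A + b j" for j
    by (simp only: reward_def fst_conv snd_conv A_def)
  then have "total s (Suc m) ?B (reward a b) = (\<Sum>k\<in>- set ?B. total s m (?B @ [k]) (reward a b)) +
      (\<Sum>j\<in>set ?B. ?x j * (A + b j))"
    unfolding total_Suc[OF s Suc.prems(1) abs_reward_le] by (simp only:)
  also have "(\<Sum>j\<in>set ?B. ?x j * (A + b j)) = ?x i * (A + b i) + (\<Sum>j\<in>set ?B - {i}. ?x j * (A + b j))"
    by (rule sum.remove) auto
  finally have total: "total s (Suc m) ?B (reward a b) = (\<Sum>k\<in>- set ?B. total s m (?B @ [k]) (reward a b)) +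
      (?x i * (A + b i) + (\<Sum>j\<in>set ?B - {i}. ?x j * (A + b j)))" .
  have "(\<Sum>k\<in>- set ?B. total s m (?B @ [k]) (reward a b)) \<le> (\<Sum>k\<in>- set ?B. flow s (?B @ [k]) * (A + v))"
  proof (rule sum_mono)
    fix k assume k: "k \<in> - set ?B"
    then have "val p a b (j k) (k # L k) \<le> v" by (intro le) (auto simp: C_def)
    then have "flow s (?B @ [k]) * (A + val p a b (j k) (k # L k)) \<le> flow s (?B @ [k]) * (A + v)"
      by (intro mult_left_mono flow_nonneg) linarith
    with Lj[OF k, folded A_def] show "total s m (?B @ [k]) (reward a b) \<le> flow s (?B @ [k]) * (A + v)"
      by linarith
  qed
  moreover have b_le: "b j \<le> v" if "j \<in> set ?B" for j
  proof -
    have "([], j) \<in> C" unfolding C_def using that by blast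
    from le[OF this] show ?thesis by simp
  qed
  have "(\<Sum>j\<in>set ?B - {i}. ?x j * (A + b j)) \<le> (\<Sum>j\<in>set ?B - {i}. ?x j * (A + v))"
    using b_le by (intro sum_mono mult_left_mono stop_flow_nonneg) auto
  \<comment> \<open>Of the flow choosing \<open>i\<close>, exactly the share \<open>1 - p i\<close>
    of the incoming flow is credited with \<open>b i\<close>; the surplus, nonnegative by
    \<open>forced\<close>, is bounded by \<open>v\<close> like every other branch.\<close>
  moreover have "?x i * (A + b i) \<le> (?x i - (1 - p i) * ?w) * (A + v) + (1 - p i) * ?w * (A + b i)"
  proof -
    have "(?x i - (1 - p i) * ?w) * (A + b i) \<le> (?x i - (1 - p i) * ?w) * (A + v)"
      using forced b_le[of i] by (intro mult_left_mono) auto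
    then show ?thesis by (simp add: algebra_simps)
  qed
  ultimately have "total s (Suc m) ?B (reward a b) \<le>
      (\<Sum>k\<in>- set ?B. flow s (?B @ [k])) * (A + v) + (\<Sum>j\<in>set ?B - {i}. ?x j) * (A + v) +
      ((?x i - (1 - p i) * ?w) * (A + v) + (1 - p i) * ?w * (A + b i))"
    unfolding total unfolding sum_distrib_right by linarith
  \<comment> \<open>By conservation the branches bounded by \<open>v\<close> add up to the share
    \<open>p i\<close> of the incoming flow, which is the recursion of \<open>val\<close>.\<close>
  also have "\<dots> = (?w - (1 - p i) * ?w) * (A + v) + (1 - p i) * ?w * (A + b i)"
  proof -
    have "(\<Sum>j\<in>set ?B. ?x j) = ?x i + (\<Sum>j\<in>set ?B - {i}. ?x j)"
      by (rule sum.remove) auto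
    then have "?w = (\<Sum>k\<in>- set ?B. flow s (?B @ [k])) + (\<Sum>j\<in>set ?B - {i}. ?x j) + ?x i"
      using flow_conservation[OF s Suc.prems(1)] by linarith
    moreover have "K * u + R * u + ((x - c) * u + e) = (w - c) * u + e" if "w = K + R + x" for K R u x c e w :: real
      unfolding that by algebra
    ultimately show ?thesis by blast
  qed
  also have "\<dots> = ?w * ((\<Sum>k\<in>set bs. a k) + val p a b j' (i # L'))"
  proof -
    have "A = (\<Sum>k\<in>set bs. a k) + a i" using Suc.prems(1) by (simp add: A_def)
    then show ?thesis by (simp add: L'(2) algebra_simps)
  qed
  finally show ?case using valid by auto
qed

text \<open>Nothing can be chosen at the empty history, so the flows into the single first boxes add
  up to 1, and the average over them is at most the best one.\<close>

lemma expected_reward_le: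
  assumes opt: "optimal c F s" and p: "\<And>i. 0 \<le> p i" "\<And>i. 1 - p i \<le> hit i"
  obtains L j where "distinct L" "j \<in> set L"
    "(\<Sum>i\<in>UNIV. a i * search_behavior F s $ i) + (\<Sum>i\<in>UNIV. b i * choice_behavior F s $ i) \<le> val p a b j L"
proof -
  have s: "strategy s" using opt by (simp add: optimal_def)
  have "measure_pmf.expectation (outcome s y) (reward a b) =
      (\<Sum>i\<in>UNIV. a i * opens s i y) + (\<Sum>i\<in>UNIV. b i * chooses s i y)" for y
  proof -
    have "reward a b = (\<lambda>x. (\<Sum>i\<in>UNIV. a i * of_bool (i \<in> set (fst x))) + (\<Sum>i\<in>UNIV. b i * of_bool (snd x = i)))"
      by (auto simp: reward_def fun_eq_iff)
    then show ?thesis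
      by (simp add: integrable_outcome[OF s] opens_def chooses_def del: sum_mult_of_bool_eq sum_of_bool_mult_eq)
  qed
  moreover have "integrable M (opens s i)" "integrable M (chooses s i)" for i
    by (rule P.integrable_const_bound[where B = 1];
        auto intro!: measurable_M measurable_opens measurable_chooses opens_bound chooses_bound s)+
  ultimately have "(\<Sum>i\<in>UNIV. a i * search_behavior F s $ i) + (\<Sum>i\<in>UNIV. b i * choice_behavior F s $ i) =
      total s (Suc CARD('n)) [] (reward a b)"
    by (simp add: total_def outcome_def[symmetric] search_behavior_eq choice_behavior_eq del: play.simps)
  also have "\<dots> = (\<Sum>k\<in>UNIV. total s CARD('n) [k] (reward a b))"
    by (subst total_Suc[OF s _ abs_reward_le]) auto
  finally have eq: "(\<Sum>i\<in>UNIV. a i * search_behavior F s $ i) + (\<Sum>i\<in>UNIV. b i * choice_behavior F s $ i) =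
      (\<Sum>k\<in>UNIV. total s CARD('n) [k] (reward a b))" .
  have "\<exists>L j. distinct (k # L) \<and> j \<in> set (k # L) \<and>
      total s CARD('n) [k] (reward a b) \<le> flow s [k] * val p a b j (k # L)" for k
    using total_le[OF opt p, of "[]" k "CARD('n)" a b] by simp
  then obtain L j where Lj: "\<And>k. distinct (k # L k) \<and> j k \<in> set (k # L k) \<and>
      total s CARD('n) [k] (reward a b) \<le> flow s [k] * val p a b (j k) (k # L k)"
    by metis
  define v where "v = Max (range (\<lambda>k. val p a b (j k) (k # L k)))"
  have "v \<in> range (\<lambda>k. val p a b (j k) (k # L k))"
    unfolding v_def by (intro Max_in) auto
  then obtain k where k: "val p a b (j k) (k # L k) = v" by force
  have "(\<Sum>k\<in>UNIV. total s CARD('n) [k] (reward a b)) \<le> (\<Sum>k\<in>UNIV. flow s [k] * v)"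
  proof (rule sum_mono)
    fix k
    have "val p a b (j k) (k # L k) \<le> v" unfolding v_def by (intro Max_ge) auto
    then have "flow s [k] * val p a b (j k) (k # L k) \<le> flow s [k] * v"
      by (intro mult_left_mono flow_nonneg)
    with Lj[of k] show "total s CARD('n) [k] (reward a b) \<le> flow s [k] * v" by linarith
  qed
  also have "\<dots> = v"
    using flow_conservation[OF s, of "[]"] by (simp add: flow_def P.prob_space sum_distrib_right[symmetric])
  finally show thesis
    using that[of "k # L k" "j k"] Lj[of k] k eq by simp
qed

text \<open>The hull of finitely many points is compact, so a behavior outside it would be strictly
  separated by a functional, contradicting the bound by some candidate.\<close>

lemma behavior_in_hull:
  assumes opt: "optimal c F s" and p: "\<And>i. 0 \<le> p i" "\<And>i. 1 - p i \<le> hit i"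
  shows "(search_behavior F s, choice_behavior F s) \<in> convex hull (points p)"
proof (rule ccontr)
  assume "\<not> ?thesis"
  then have "\<exists>w \<beta>. inner w (search_behavior F s, choice_behavior F s) < \<beta> \<and>
      (\<forall>x\<in>convex hull (points p). \<beta> < inner w x)"
    by (intro separating_hyperplane_closed_point convex_convex_hull compact_imp_closed
        finite_imp_compact_convex_hull finite_points)
  then obtain w \<beta> where w: "inner w (search_behavior F s, choice_behavior F s) < \<beta>"
      "\<And>x. x \<in> convex hull (points p) \<Longrightarrow> \<beta> < inner w x"
    by blast
  \<comment> \<open>The separation puts the behavior strictly below the hull, whereas the bound is
    from above; hence the negated coefficients.\<close>
  obtain L j where L: "distinct L" "j \<in> set L" and le:
    "(\<Sum>i\<in>UNIV. - fst w $ i * search_behavior F s $ i) + (\<Sum>i\<in>UNIV. - snd w $ i * choice_behavior F s $ i)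
      \<le> val p (\<lambda>i. - fst w $ i) (\<lambda>i. - snd w $ i) j L"
    by (rule expected_reward_le[OF opt p])
  from le have "inner w (point p L j) \<le> inner w (search_behavior F s, choice_behavior F s)"
    unfolding val_eq[OF L(1)] by (simp add: point_def inner_prod_def inner_vec_def sum_negf)
  moreover have "L \<noteq> []" using L by auto
  then have "point p L j \<in> points p" using L unfolding points_def by blast
  then have "\<beta> < inner w (point p L j)" by (intro w(2) hull_inc)
  ultimately show False using w(1) by linarith
qed

end

section \<open>Behavior determined by the choices\<close>

text \<open>Mean payoff of passing along the list when box \<open>x\<close> stops with probability
  \<open>h x\<close> and pays \<open>w x\<close>, and reaching the end pays \<open>e\<close>. With
  0/1 probabilities it describes a single path, so one recursion covers realized choices, their
  means and the exposing functional.\<close>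

primrec walk :: "('n \<Rightarrow> real) \<Rightarrow> real \<Rightarrow> ('n \<Rightarrow> real) \<Rightarrow> 'n list \<Rightarrow> real" where
  "walk w e h [] = e"
| "walk w e h (x # L) = h x * w x + (1 - h x) * walk w e h L"

lemma chosen_eq_walk: "chosen (\<lambda>i. 1 - h i) j L k = walk (\<lambda>x. of_bool (k = x)) (of_bool (k = j)) h L"
  by (induction L) auto

lemma opened_eq_walk:
  "distinct L \<Longrightarrow> h k * opened (\<lambda>i. 1 - h i) L k = walk (\<lambda>x. of_bool (k = x)) 0 h L"
proof (induction L)
  case (Cons x L)
  then show ?case using opened_notin[of x L "\<lambda>i. 1 - h i"] by (cases "k = x") auto
qed simp

primrec pick :: "('n \<Rightarrow> bool) \<Rightarrow> 'n \<Rightarrow> 'n list \<Rightarrow> 'n" where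
  "pick P j [] = j"
| "pick P j (x # L) = (if P x then x else pick P j L)"

lemma of_bool_pick:
  "of_bool (k = pick P j L) = walk (\<lambda>x. of_bool (k = x)) (of_bool (k = j)) (\<lambda>i. of_bool (P i)) L"
  by (induction L) auto

text \<open>The disjunction is what survives the induction: once \<open>j\<close> has been passed it
  may be missing from the tail, but then it is known to fail \<open>P\<close>, so the fallback
  contributes 0.\<close>

lemma of_bool_pick_hot:
  "j \<in> set L \<or> \<not> P j \<Longrightarrow>
    of_bool (k = pick P j L \<and> P k) = walk (\<lambda>x. of_bool (k = x)) 0 (\<lambda>i. of_bool (P i)) L"
proof (induction L)
  case (Cons x L)
  show ?case
  proof (cases "P x")
    case False
    with Cons.prems have "j \<in> set L \<or> \<not> P j" by auto
    from Cons.IH[OF this] False show ?thesis by simp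
  qed auto
qed auto

lemma pick_append: "\<forall>i\<in>set L1. \<not> P i \<Longrightarrow> pick P j (L1 @ L2) = pick P j L2"
  by (induction L1) auto

lemma pick_cases:
  obtains L1 k L2 where "L = L1 @ k # L2" "P k" "\<forall>i\<in>set L1. \<not> P i" "pick P j L = k"
  | "\<forall>i\<in>set L. \<not> P i" "pick P j L = j"
proof (cases "\<exists>k\<in>set L. P k")
  case True
  then obtain L1 k L2 where "L = L1 @ k # L2" "P k" "\<forall>i\<in>set L1. \<not> P i"
    using split_list_first_prop[of L P] by blast
  then show thesis using that(1) by (simp add: pick_append)
next
  case False
  then show thesis using that(2) pick_append[of L P j "[]"] by simp
qed

lemma opened_bounds:
  assumes "\<And>i. 0 < p i" "\<And>i. p i < 1"
  shows "k \<in> set L \<Longrightarrow> 0 < opened p L k" "opened p L k \<le> 1"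
proof -
  show "0 < opened p L k" if "k \<in> set L" using that assms by (induction L) auto
  have "0 \<le> p i" "p i \<le> 1" for i using assms by (auto intro: less_imp_le)
  then have "0 \<le> opened p L k \<and> opened p L k \<le> 1"
    by (induction L) (auto intro!: mult_le_one)
  then show "opened p L k \<le> 1" by simp
qed

text \<open>Besides ordering search probabilities, the case with constant probability 1/2 provides
  weights that are positive and strictly decreasing along \<open>L\<close> and zero off it.\<close>

lemma opened_decreasing:
  assumes "\<And>i. 0 < p i" "\<And>i. p i < 1"
  shows "distinct L \<Longrightarrow> sorted_wrt (\<lambda>a b. opened p L b < opened p L a) L"
proof (induction L)
  case (Cons x L)
  have "opened p (x # L) k < 1" if "k \<in> set L" for k
  proof -
    have "p x * opened p L k \<le> p x * 1"
      using assms opened_bounds(2)[of p L k] by (intro mult_left_mono) (auto intro: less_imp_le)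
    then show ?thesis using that Cons.prems assms(2)[of x] by auto
  qed
  moreover have "sorted_wrt (\<lambda>a b. opened p (x # L) b < opened p (x # L) a) L"
    by (rule sorted_wrt_mono_rel[OF _ Cons.IH]) (use Cons.prems assms in auto)
  ultimately show ?case by simp
qed simp

lemma tendsto_opened:
  assumes "\<And>i. ((\<lambda>x. f x i) \<longlongrightarrow> p i) G"
  shows "((\<lambda>x. opened (f x) L k) \<longlongrightarrow> opened p L k) G"
proof (induction L)
  case (Cons y L)
  then show ?case by (cases "k = y") (simp_all add: tendsto_mult[OF assms])
qed simp

lemma tendsto_chosen:
  assumes "\<And>i. ((\<lambda>x. f x i) \<longlongrightarrow> p i) G"
  shows "((\<lambda>x. chosen (f x) j L k) \<longlongrightarrow> chosen p j L k) G"
proof (induction L)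
  case (Cons y L)
  then show ?case unfolding chosen.simps
    by (intro tendsto_add tendsto_mult tendsto_diff tendsto_const assms)
qed simp

context boxes begin

text \<open>Each box occurs once in \<open>L\<close>, so the indicator at the head is independent of
  the walk along the tail; integration replaces indicators by \<open>hit\<close>.\<close>

lemma integral_walk:
  assumes "distinct L"
  shows "(\<integral>y. walk w e (\<lambda>i. of_bool (\<zeta> i < y i)) L \<partial>M) = walk w e hit L"
    and "(\<lambda>y. walk w e (\<lambda>i. of_bool (\<zeta> i < y i)) L) \<in> borel_measurable (Pi\<^sub>M UNIV (\<lambda>_. borel))"
proof -
  let ?W = "\<lambda>L y. walk w e (\<lambda>i. of_bool (\<zeta> i < y i)) L"
  have bound: "\<exists>B. \<forall>y. \<bar>?W L y\<bar> \<le> B" for L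
  proof (induction L)
    case (Cons x L)
    then obtain B where "\<And>y. \<bar>?W L y\<bar> \<le> B" by blast
    then have "\<bar>?W (x # L) y\<bar> \<le> max \<bar>w x\<bar> B" for y by (auto simp: le_max_iff_disj)
    then show ?case by blast
  qed auto
  have upd: "x \<notin> set L \<Longrightarrow> ?W L (y(x := t)) = ?W L y" for x L y t
    by (induction L) auto
  have meas: "?W L \<in> borel_measurable (Pi\<^sub>M UNIV (\<lambda>_. borel))" for L
    by (induction L) (simp_all)
  then show "?W L \<in> borel_measurable (Pi\<^sub>M UNIV (\<lambda>_. borel))" .
  show "(\<integral>y. ?W L y \<partial>M) = walk w e hit L"
    using assms
  proof (induction L)
    case Nil
    then show ?case by (simp add: P.prob_space)
  next
    case (Cons x L)
    obtain B where B: "\<And>y. \<bar>?W L y\<bar> \<le> B" using bound by blast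
    have int: "integrable (F x) (\<lambda>t. 1 - of_bool (\<zeta> x < t) :: real)"
      and val: "(\<integral>t. 1 - of_bool (\<zeta> x < t) \<partial>F x) = 1 - hit x"
      using integral_hot[of x] prob_space.prob_space[OF prob_space_F[of x]] by simp_all
    have "x \<notin> set L" using Cons.prems by simp
    note W = integral_mult_component[OF meas[of L] B upd[OF this] int]
    have hot: "integrable M (\<lambda>y. of_bool (\<zeta> x < y x) * w x)"
      "(\<integral>y. of_bool (\<zeta> x < y x) \<partial>M) = hit x"
      using integral_mult_component[of "\<lambda>_. 1" 1 x, OF _ _ _ integral_hot(1)] integral_hot(2)[of x]
      by (simp_all add: P.prob_space)
    have "(\<integral>y. ?W (x # L) y \<partial>M) = (\<integral>y. of_bool (\<zeta> x < y x) * w x + ?W L y * (1 - of_bool (\<zeta> x < y x)) \<partial>M)"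
      by (intro Bochner_Integration.integral_cong) auto
    also have "\<dots> = hit x * w x + walk w e hit L * (1 - hit x)"
      using W hot Cons val by (subst Bochner_Integration.integral_add) auto
    finally show ?case by simp
  qed
qed

text \<open>The search behavior is determined by the choices: box \<open>i\<close> is opened independently of its value,
  and whenever that value exceeds \<open>\<zeta> i\<close> an opened box is chosen.\<close>

lemma behavior_approx:
  assumes opt: "optimal c F s" and L: "distinct L" "j \<in> set L"
    and bad: "Measurable.pred (Pi\<^sub>M UNIV (\<lambda>_. borel)) bad" "(\<integral>y. of_bool (bad y) \<partial>M) \<le> \<eta>"
    and pick: "AE y in M. \<not> bad y \<longrightarrow> (\<forall>x\<in>set_pmf (outcome s y). snd x = pick (\<lambda>i. \<zeta> i < y i) j L)"
  shows "\<bar>chosen (\<lambda>i. 1 - hit i) j L k - choice_behavior F s $ k\<bar> \<le> \<eta>"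
    and "hit k * \<bar>opened (\<lambda>i. 1 - hit i) L k - search_behavior F s $ k\<bar> \<le> \<eta>"
proof -
  have s: "strategy s" and AE: "AE y in M. \<forall>x\<in>set_pmf (outcome s y). weitzman_outcome y x"
    using opt by (simp_all add: optimal_iff)
  let ?hot = "\<lambda>k y. of_bool (\<zeta> k < y k) :: real"
  let ?pick = "\<lambda>y. pick (\<lambda>i. \<zeta> i < y i) j L"
  have int_bad: "integrable M (\<lambda>y. of_bool (bad y) :: real)"
    using bad(1) by (intro P.integrable_const_bound[where B = 1] measurable_M) auto
  have diff: "\<bar>(\<integral>y. f y \<partial>M) - (\<integral>y. g y \<partial>M)\<bar> \<le> \<eta>"
    if fg: "f \<in> borel_measurable (Pi\<^sub>M UNIV (\<lambda>_. borel))" "g \<in> borel_measurable (Pi\<^sub>M UNIV (\<lambda>_. borel))"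
      "\<And>y. 0 \<le> f y \<and> f y \<le> 1" "\<And>y. 0 \<le> g y \<and> g y \<le> 1"
      and eq: "AE y in M. \<not> bad y \<longrightarrow> f y = g y"
    for f g :: "('n \<Rightarrow> real) \<Rightarrow> real"
  proof -
    have int: "integrable M f" "integrable M g"
      using fg by (auto intro!: P.integrable_const_bound[where B = 1] measurable_M)
    have "\<bar>\<integral>y. f y - g y \<partial>M\<bar> \<le> (\<integral>y. \<bar>f y - g y\<bar> \<partial>M)" by (rule integral_abs_bound)
    also have "\<dots> \<le> (\<integral>y. of_bool (bad y) \<partial>M)"
    proof (rule integral_mono_AE)
      show "AE y in M. \<bar>f y - g y\<bar> \<le> of_bool (bad y)"
        using eq
      proof eventually_elim
        case (elim y)
        then show ?case using fg(3)[of y] fg(4)[of y] by (cases "bad y") auto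
      qed
    qed (use int int_bad in auto)
    finally show ?thesis using bad(2) int by simp
  qed
  have chooses01: "0 \<le> chooses s k y \<and> chooses s k y \<le> 1" for y
    using chooses_bound[OF s, of k y] unfolding chooses_def
    by (auto intro!: Bochner_Integration.integral_nonneg)
  have chooses: "AE y in M. \<not> bad y \<longrightarrow> chooses s k y = of_bool (k = ?pick y)"
    using pick
  proof eventually_elim
    case (elim y)
    show ?case
    proof
      assume "\<not> bad y"
      then have "chooses s k y = measure_pmf.expectation (outcome s y) (\<lambda>x. of_bool (k = ?pick y))"
        unfolding chooses_def using elim by (intro expectation_pmf_cong) auto
      then show "chooses s k y = of_bool (k = ?pick y)" by simp
    qed
  qed
  have "\<bar>(\<integral>y. of_bool (k = ?pick y) \<partial>M) - (\<integral>y. chooses s k y \<partial>M)\<bar> \<le> \<eta>"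
  proof (rule diff)
    show "(\<lambda>y. of_bool (k = ?pick y) :: real) \<in> borel_measurable (Pi\<^sub>M UNIV (\<lambda>_. borel))"
      unfolding of_bool_pick by (rule integral_walk(2)[OF L(1)])
    show "chooses s k \<in> borel_measurable (Pi\<^sub>M UNIV (\<lambda>_. borel))" by (rule measurable_chooses[OF s])
    show "AE y in M. \<not> bad y \<longrightarrow> of_bool (k = ?pick y) = chooses s k y"
      using chooses by eventually_elim auto
  qed (use chooses01 in auto)
  then show "\<bar>chosen (\<lambda>i. 1 - hit i) j L k - choice_behavior F s $ k\<bar> \<le> \<eta>"
    unfolding choice_behavior_eq of_bool_pick integral_walk(1)[OF L(1)] chosen_eq_walk .
  have hot_meas: "?hot k \<in> borel_measurable (Pi\<^sub>M UNIV (\<lambda>_. borel))" by measurable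
  \<comment> \<open>The comparison of choices is repeated on the event that \<open>y k\<close>
    exceeds \<open>\<zeta> k\<close>, where choosing and opening \<open>k\<close> coincide.\<close>
  have "\<bar>(\<integral>y. of_bool (k = ?pick y \<and> \<zeta> k < y k) \<partial>M) - (\<integral>y. chooses s k y * ?hot k y \<partial>M)\<bar> \<le> \<eta>"
  proof (rule diff)
    show "(\<lambda>y. of_bool (k = ?pick y \<and> \<zeta> k < y k) :: real) \<in> borel_measurable (Pi\<^sub>M UNIV (\<lambda>_. borel))"
      using L(2) by (subst of_bool_pick_hot) (auto intro: integral_walk(2)[OF L(1)])
    show "(\<lambda>y. chooses s k y * ?hot k y) \<in> borel_measurable (Pi\<^sub>M UNIV (\<lambda>_. borel))"
      by (intro borel_measurable_times measurable_chooses[OF s] hot_meas)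
    show "AE y in M. \<not> bad y \<longrightarrow> of_bool (k = ?pick y \<and> \<zeta> k < y k) = chooses s k y * ?hot k y"
      using chooses by eventually_elim auto
  qed (use chooses01 in auto)
  also have "(\<integral>y. of_bool (k = ?pick y \<and> \<zeta> k < y k) \<partial>M) = hit k * opened (\<lambda>i. 1 - hit i) L k"
    using L(2) by (subst of_bool_pick_hot) (auto simp: integral_walk(1)[OF L(1)] opened_eq_walk[OF L(1)])
  also have "(\<integral>y. chooses s k y * ?hot k y \<partial>M) = (\<integral>y. opens s k y * ?hot k y \<partial>M)"
  proof (rule integral_cong_AE)
    show "AE y in M. chooses s k y * ?hot k y = opens s k y * ?hot k y"
      using AE
    proof eventually_elim
      case (elim y)
      have "chooses s k y = opens s k y" if "\<zeta> k < y k"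
        unfolding chooses_def opens_def
      proof (rule expectation_pmf_cong)
        fix x assume x: "x \<in> set_pmf (outcome s y)"
        have w: "weitzman_outcome y x" using elim x by blast
        have "snd x \<in> set (fst x)" using outcome_chosen[OF s, of "fst x" "snd x" y] x by simp
        then have "snd x = k \<longleftrightarrow> k \<in> set (fst x)"
          using that w unfolding weitzman_outcome_def by blast
        then show "of_bool (snd x = k) = (of_bool (k \<in> set (fst x)) :: real)" by simp
      qed
      then show ?case by (cases "\<zeta> k < y k") simp_all
    qed
  qed (rule measurable_M, intro borel_measurable_times measurable_chooses[OF s] measurable_opens[OF s] hot_meas)+
  \<comment> \<open>Opening \<open>k\<close> is independent of \<open>y k\<close>, which brings out
    the factor \<open>hit k\<close>.\<close>
  also have "\<dots> = search_behavior F s $ k * hit k"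
    unfolding search_behavior_eq integral_hot(2)[symmetric]
    by (rule integral_mult_component(2)[where \<psi> = "\<lambda>t. of_bool (\<zeta> k < t)",
          OF measurable_opens[OF s] opens_bound[OF s] opens_upd[OF s] integral_hot(1)])
  finally have "\<bar>hit k * (opened (\<lambda>i. 1 - hit i) L k - search_behavior F s $ k)\<bar> \<le> \<eta>"
    by (simp add: algebra_simps)
  then show "hit k * \<bar>opened (\<lambda>i. 1 - hit i) L k - search_behavior F s $ k\<bar> \<le> \<eta>"
    using hit_pos[of k] by (simp add: abs_mult)
qed

end

section \<open>Realizing the candidate vertices\<close>

definition three_point :: "real \<Rightarrow> real \<Rightarrow> real \<Rightarrow> real \<Rightarrow> real \<Rightarrow> real measure" where
  "three_point a w b q r = distr (measure_pmf (pmf_of_list [(b, q), (w, r), (a, 1 - q - r)])) borel (\<lambda>x. x)"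

lemma real_distribution_three_point: "real_distribution (three_point a w b q r)"
proof -
  interpret prob_space "three_point a w b q r"
    unfolding three_point_def by (rule measure_pmf.prob_space_distr) simp
  show ?thesis by standard (simp add: three_point_def)
qed

context
  fixes a w b q r :: real
  assumes order: "a < w" "w < b" and weights: "0 \<le> q" "0 \<le> r" "q + r \<le> 1"
begin

lemma pmf_of_list_wf_three_point: "pmf_of_list_wf [(b, q), (w, r), (a, 1 - q - r)]"
  using weights by (simp add: pmf_of_list_wf_def)

lemma integral_three_point:
  assumes "f \<in> borel_measurable borel"
  shows "(\<integral>x. f x \<partial>three_point a w b q r) = q * f b + r * f w + (1 - q - r) * (f a :: real)"
proof -
  have "(\<integral>x. f x \<partial>three_point a w b q r) =
      measure_pmf.expectation (pmf_of_list [(b, q), (w, r), (a, 1 - q - r)]) f"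
    unfolding three_point_def using assms by (subst integral_distr) auto
  also have "\<dots> = (\<Sum>x\<in>{b, w, a}. f x * pmf (pmf_of_list [(b, q), (w, r), (a, 1 - q - r)]) x)"
    using set_pmf_of_list[OF pmf_of_list_wf_three_point] by (intro integral_measure_pmf_real) auto
  also have "\<dots> = q * f b + r * f w + (1 - q - r) * f a"
    using order by (simp add: pmf_pmf_of_list[OF pmf_of_list_wf_three_point])
  finally show ?thesis .
qed

text \<open>The condition on \<open>a\<close> is asked only when its weight is positive, so that one
  family also covers the laws without a low atom.\<close>

lemma AE_three_point:
  assumes "Measurable.pred borel P" "P b" "P w" "q + r < 1 \<Longrightarrow> P a"
  shows "AE x in three_point a w b q r. P x"
proof -
  have "AE x in measure_pmf (pmf_of_list [(b, q), (w, r), (a, 1 - q - r)]). P x"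
    unfolding AE_measure_pmf_iff
  proof
    fix x assume x: "x \<in> set_pmf (pmf_of_list [(b, q), (w, r), (a, 1 - q - r)])"
    then have "x \<in> {b, w, a}"
      using set_pmf_of_list[OF pmf_of_list_wf_three_point] by auto
    moreover have "q + r < 1" if "x = a"
      using x that order weights by (auto simp: set_pmf_iff pmf_pmf_of_list[OF pmf_of_list_wf_three_point])
    ultimately show "P x" using assms by auto
  qed
  then show ?thesis
    unfolding three_point_def using assms(1) by (subst AE_distr_iff) (auto simp: pred_def)
qed

end

section \<open>The problem with equal lower reservation values\<close>

locale box_problem =
  fixes lo hi lam c :: "'n::{finite,linorder} \<Rightarrow> real" and z :: real
  assumes lo_nonneg: "\<And>i. 0 \<le> lo i" and lo_less_hi: "\<And>i. lo i < hi i" and hi_le_1: "\<And>i. hi i \<le> 1"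
    and lam: "\<And>i. 0 < lam i" "\<And>i. lam i < 1"
    and c_pos: "\<And>i. 0 < c i" and c_less: "\<And>i. c i < lam i * (hi i - lo i)"
    and mean_minus_cost: "\<And>i. prior_mean lo hi lam i - c i = z"
begin

abbreviation \<mu> :: "'n \<Rightarrow> real" where "\<mu> \<equiv> prior_mean lo hi lam"

definition p :: "'n \<Rightarrow> real" where "p i = 1 - c i / (hi i - z)"

lemma mean: "\<mu> i = z + c i"
  using mean_minus_cost[of i] by simp

lemma mean_bounds: "c i < \<mu> i - lo i" "\<mu> i < hi i"
proof -
  have "\<mu> i - lo i = lam i * (hi i - lo i)" by (simp add: prior_mean_def algebra_simps)
  then show "c i < \<mu> i - lo i" using c_less by simp
  have "hi i - \<mu> i = (1 - lam i) * (hi i - lo i)" by (simp add: prior_mean_def algebra_simps)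
  moreover have "0 < (1 - lam i) * (hi i - lo i)" using lam lo_less_hi by simp
  ultimately show "\<mu> i < hi i" by simp
qed

lemma lo_less_z: "lo i < z" and z_less_hi: "z < hi i" and c_less_hi: "c i < hi i - z"
  using mean_bounds[of i] mean[of i] c_pos[of i] by linarith+

lemma p_bounds: "0 < p i" "p i < 1"
  using c_less_hi[of i] c_pos[of i] z_less_hi[of i] by (simp_all add: p_def)

text \<open>The expected excess over a threshold is 1-Lipschitz in the threshold, at least
  \<open>c i\<close> at \<open>z\<close> by the mean constraint and 0 at \<open>hi i\<close>; the
  intermediate value theorem gives \<open>\<zeta>\<close>. An excess is at most
  \<open>hi i - \<zeta> i\<close>, so \<open>hit\<close> cannot be small.\<close>

lemma feasible_profile_boxes:
  assumes F: "feasible_profile lo hi lam F"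
  obtains \<zeta> where "boxes F c \<zeta>" "\<And>i. 1 - p i \<le> boxes.hit F \<zeta> i"
proof -
  have dist: "real_distribution (F i)" and support: "AE y in F i. lo i \<le> y \<and> y \<le> hi i"
    and mean_F: "(\<integral>y. y \<partial>F i) = \<mu> i" for i
    using F by (auto simp: feasible_profile_def)
  have sets: "sets (F i) = sets borel" for i
    using dist[of i] by (simp add: real_distribution_def real_distribution_axioms_def)
  have "\<exists>\<zeta>\<ge>z. \<zeta> < hi i \<and> (\<integral>y. max 0 (y - \<zeta>) \<partial>F i) = c i" for i
  proof -
    interpret real_distribution "F i" by (rule dist)
    have int: "integrable (F i) (\<lambda>y. y)"
      by (rule integrable_const_bound[where B = 1])
         (use support[of i] lo_nonneg[of i] hi_le_1[of i] in auto)
    have int': "integrable (F i) (\<lambda>y. max 0 (y - t))" for t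
      using int by (intro Bochner_Integration.integrable_max) auto
    define g where "g t = (\<integral>y. max 0 (y - t) \<partial>F i)" for t
    have lip: "\<bar>g t - g u\<bar> \<le> \<bar>t - u\<bar>" for t u
    proof -
      have "\<bar>g t - g u\<bar> = \<bar>\<integral>y. max 0 (y - t) - max 0 (y - u) \<partial>F i\<bar>"
        unfolding g_def using int' by simp
      also have "\<dots> \<le> (\<integral>y. \<bar>max 0 (y - t) - max 0 (y - u)\<bar> \<partial>F i)" by (rule integral_abs_bound)
      also have "\<dots> \<le> (\<integral>y. \<bar>t - u\<bar> \<partial>F i)"
        using int' by (intro integral_mono) auto
      finally show ?thesis using prob_space by simp
    qed
    have "continuous_on {z..hi i} g"
      unfolding continuous_on_iff dist_real_def using lip by (meson le_less_trans)
    moreover have hi0: "g (hi i) = 0"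
    proof -
      have "g (hi i) = (\<integral>y. 0 \<partial>F i)"
        unfolding g_def by (rule integral_cong_AE) (use support[of i] in auto)
      then show ?thesis by simp
    qed
    moreover have "c i \<le> g z"
    proof -
      have "c i = (\<integral>y. y - z \<partial>F i)" using int mean_F[of i] mean[of i] prob_space by simp
      also have "\<dots> \<le> g z" unfolding g_def using int int' by (intro integral_mono) auto
      finally show ?thesis .
    qed
    ultimately obtain \<zeta> where "z \<le> \<zeta>" "\<zeta> \<le> hi i" "g \<zeta> = c i"
      using IVT2'[of g "hi i" "c i" z] c_pos[of i] z_less_hi[of i] by auto
    moreover have "\<zeta> \<noteq> hi i" using hi0 \<open>g \<zeta> = c i\<close> c_pos[of i] by auto
    ultimately show ?thesis unfolding g_def by (intro exI[of _ \<zeta>]) auto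
  qed
  then obtain \<zeta> where \<zeta>: "\<And>i. z \<le> \<zeta> i" "\<And>i. \<zeta> i < hi i" "\<And>i. (\<integral>y. max 0 (y - \<zeta> i) \<partial>F i) = c i"
    by metis
  interpret boxes F c \<zeta>
  proof (rule boxes.intro)
    fix i show "AE y in F i. 0 \<le> y \<and> y \<le> 1"
      using support[of i] by eventually_elim (use lo_nonneg[of i] hi_le_1[of i] in auto)
  qed (use dist c_pos \<zeta> in auto)
  have "1 - p i \<le> hit i" for i
  proof -
    have "c i \<le> (\<integral>y. (hi i - \<zeta> i) * of_bool (\<zeta> i < y) \<partial>F i)"
      unfolding \<zeta>(3)[symmetric]
    proof (rule integral_mono_AE)
      show "AE y in F i. max 0 (y - \<zeta> i) \<le> (hi i - \<zeta> i) * of_bool (\<zeta> i < y)"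
        using support[of i] by eventually_elim (use \<zeta>(2)[of i] in auto)
    qed (use integrable_excess integral_hot(1) in auto)
    also have "\<dots> = (hi i - \<zeta> i) * hit i" using integral_hot[of i] by simp
    also have "\<dots> \<le> (hi i - z) * hit i"
      using \<zeta>(1)[of i] hit_pos[of i] by (intro mult_right_mono) auto
    finally show ?thesis using z_less_hi[of i] by (simp add: p_def field_simps)
  qed
  then show thesis using that boxes_axioms by blast
qed

lemma feasible_pairs_subset_hull: "feasible_pairs lo hi lam c \<subseteq> convex hull (points p)"
proof
  fix t assume "t \<in> feasible_pairs lo hi lam c"
  then obtain F s where F: "feasible_profile lo hi lam F" and s: "optimal c F s"
    and t: "t = (search_behavior F s, choice_behavior F s)"
    by (auto simp: feasible_pairs_def)
  from F obtain \<zeta> where \<zeta>: "boxes F c \<zeta>" "\<And>i. 1 - p i \<le> boxes.hit F \<zeta> i"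
    by (rule feasible_profile_boxes) blast
  show "t \<in> convex hull (points p)"
    unfolding t using boxes.behavior_in_hull[OF \<zeta>(1) s] p_bounds(1) \<zeta>(2) by (simp add: less_imp_le)
qed

text \<open>The weights of \<open>hi i\<close> and \<open>w i\<close> for which the law on \<open>{lo i, w i, hi i}\<close> has mean \<open>\<mu> i\<close> and reservation
  value \<open>\<zeta> i\<close>.  For \<open>\<zeta> = w = z\<close> the mass at \<open>lo i\<close> vanishes.\<close>

definition q :: "('n \<Rightarrow> real) \<Rightarrow> 'n \<Rightarrow> real" where "q \<zeta> i = c i / (hi i - \<zeta> i)"

definition r :: "('n \<Rightarrow> real) \<Rightarrow> ('n \<Rightarrow> real) \<Rightarrow> 'n \<Rightarrow> real" where
  "r \<zeta> w i = (\<mu> i - lo i - q \<zeta> i * (hi i - lo i)) / (w i - lo i)"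

definition law :: "('n \<Rightarrow> real) \<Rightarrow> ('n \<Rightarrow> real) \<Rightarrow> 'n \<Rightarrow> real measure" where
  "law \<zeta> w i = three_point (lo i) (w i) (hi i) (q \<zeta> i) (r \<zeta> w i)"

text \<open>The last inequality is nonnegativity of \<open>r\<close>. That \<open>q\<close> and
  \<open>r\<close> add up to at most 1 follows from \<open>z \<le> w i\<close>,
  \<open>w i \<le> \<zeta> i\<close> and the mean being \<open>z + c i\<close>.\<close>

definition admissible :: "('n \<Rightarrow> real) \<Rightarrow> ('n \<Rightarrow> real) \<Rightarrow> bool" where
  "admissible \<zeta> w \<longleftrightarrow> (\<forall>i. z \<le> w i \<and> w i \<le> \<zeta> i \<and> \<zeta> i < hi i \<and>
    q \<zeta> i * (hi i - lo i) \<le> \<mu> i - lo i)"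

context
  fixes \<zeta> w
  assumes adm: "admissible \<zeta> w"
begin

lemma admD: "lo i < w i" "w i < hi i" "z \<le> w i" "w i \<le> \<zeta> i" "\<zeta> i < hi i"
  using adm[unfolded admissible_def, rule_format, of i] lo_less_z[of i] by auto

lemma q_mult: "q \<zeta> i * (hi i - \<zeta> i) = c i"
  using admD(5)[of i] by (simp add: q_def)

lemma r_mult: "r \<zeta> w i * (w i - lo i) = \<mu> i - lo i - q \<zeta> i * (hi i - lo i)"
  using admD(1)[of i] by (simp add: r_def)

lemma weights: "0 \<le> q \<zeta> i" "0 \<le> r \<zeta> w i" "q \<zeta> i + r \<zeta> w i \<le> 1"
proof -
  show q: "0 \<le> q \<zeta> i" using admD(5)[of i] c_pos[of i] by (simp add: q_def)
  show "0 \<le> r \<zeta> w i"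
    using admD(1)[of i] adm by (simp add: r_def admissible_def)
  have "q \<zeta> i * (hi i - w i) = c i + q \<zeta> i * (\<zeta> i - w i)"
    unfolding q_mult[of i, symmetric] by (simp add: algebra_simps)
  moreover have "0 \<le> q \<zeta> i * (\<zeta> i - w i)" using q admD(4)[of i] by simp
  ultimately have "r \<zeta> w i * (w i - lo i) \<le> (1 - q \<zeta> i) * (w i - lo i)"
    unfolding r_mult using admD(3)[of i] mean[of i] by (simp add: algebra_simps)
  then show "q \<zeta> i + r \<zeta> w i \<le> 1" using admD(1)[of i] by (simp add: mult_le_cancel_right)
qed

lemmas three_point_facts = admD(1,2) weights

lemma integral_law: "f \<in> borel_measurable borel \<Longrightarrow>
    (\<integral>x. f x \<partial>law \<zeta> w i) = q \<zeta> i * f (hi i) + r \<zeta> w i * f (w i) + (1 - q \<zeta> i - r \<zeta> w i) * (f (lo i) :: real)"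
  unfolding law_def by (rule integral_three_point[OF three_point_facts])

lemma AE_law:
  assumes "Measurable.pred borel P" "P (hi i)" "P (w i)" "q \<zeta> i + r \<zeta> w i < 1 \<Longrightarrow> P (lo i)"
  shows "AE x in law \<zeta> w i. P x"
  unfolding law_def by (rule AE_three_point[OF three_point_facts assms])

lemma feasible_law: "feasible_profile lo hi lam (law \<zeta> w)"
  unfolding feasible_profile_def
proof (intro allI conjI)
  fix i
  show "real_distribution (law \<zeta> w i)" unfolding law_def by (rule real_distribution_three_point)
  show "AE y in law \<zeta> w i. lo i \<le> y \<and> y \<le> hi i"
    by (rule AE_law) (use admD[of i] in auto)
  have "(\<integral>y. y \<partial>law \<zeta> w i) = lo i + q \<zeta> i * (hi i - lo i) + r \<zeta> w i * (w i - lo i)"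
    by (subst integral_law) (simp_all add: algebra_simps)
  then show "(\<integral>y. y \<partial>law \<zeta> w i) = \<mu> i" by (simp add: r_mult)
qed

lemma boxes_law: "boxes (law \<zeta> w) c \<zeta>"
proof (rule boxes.intro)
  fix i
  show "real_distribution (law \<zeta> w i)" unfolding law_def by (rule real_distribution_three_point)
  show "AE y in law \<zeta> w i. 0 \<le> y \<and> y \<le> 1"
    by (rule AE_law) (use admD[of i] lo_nonneg[of i] hi_le_1[of i] lo_less_hi[of i] in auto)
  show "(\<integral>y. max 0 (y - \<zeta> i) \<partial>law \<zeta> w i) = c i"
    using admD[of i] q_mult[of i] by (subst integral_law) auto
qed (rule c_pos)

lemma hit_law: "boxes.hit (law \<zeta> w) \<zeta> i = q \<zeta> i"
  using admD[of i] by (subst boxes.integral_hot(2)[OF boxes_law, symmetric], subst integral_law) auto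

end

lemma q_z: "q (\<lambda>_. z) i = 1 - p i"
  by (simp add: q_def p_def)

text \<open>The numerator of \<open>r\<close> for reservation value \<open>z\<close>: with
  \<open>w = z\<close> it yields \<open>r = p\<close>, so the two upper weights exhaust the
  mass.\<close>

lemma mean_z: "\<mu> i - lo i - (1 - p i) * (hi i - lo i) = p i * (z - lo i)"
proof -
  have "(1 - p i) * (hi i - z) = c i" using z_less_hi[of i] by (simp add: p_def)
  then show ?thesis by (simp add: mean algebra_simps)
qed

text \<open>With every reservation value equal to \<open>z\<close> and every value at least
  \<open>z\<close>, searching along any list is optimal, and so is every way of breaking the tie at
  \<open>z\<close>.\<close>

lemma point_in_feasible_pairs:
  assumes L: "distinct L" "j \<in> set L"
  shows "point p L j \<in> feasible_pairs lo hi lam c"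
proof -
  let ?\<zeta> = "\<lambda>_::'n. z" and ?s = "list_strategy (\<lambda>_::'n. z) L j"
  have adm: "admissible ?\<zeta> ?\<zeta>"
    unfolding admissible_def q_z
  proof (intro allI conjI)
    fix i
    have "0 \<le> p i * (z - lo i)" using p_bounds(1)[of i] lo_less_z[of i] by simp
    then show "(1 - p i) * (hi i - lo i) \<le> \<mu> i - lo i" using mean_z[of i] by linarith
  qed (use z_less_hi in auto)
  have r: "r ?\<zeta> ?\<zeta> i = p i" for i
    unfolding r_def q_z mean_z using lo_less_z[of i] by simp
  interpret boxes "law ?\<zeta> ?\<zeta>" c ?\<zeta> by (rule boxes_law[OF adm])
  have AE: "AE y in M. \<forall>i. y i = hi i \<or> y i = z"
    by (rule AE_all_components, rule AE_law[OF adm]) (auto simp: q_z r)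
  have ne: "L \<noteq> []" using L by auto
  have "AE y in M. \<forall>x\<in>set_pmf (outcome ?s y). weitzman_outcome y x"
    using AE
  proof eventually_elim
    case (elim y)
    then have "z \<le> y i" for i using z_less_hi[of i] by (metis order.refl less_imp_le)
    then show ?case
      using weitzman_list_strategy[OF L(1) ne _ _, of y] by (auto simp: sorted_wrt_true)
  qed
  then have opt: "optimal c (law ?\<zeta> ?\<zeta>) ?s"
    using strategy_list_strategy[OF L(1) ne] by (simp add: optimal_iff)
  \<comment> \<open>The exceptional event is empty here, so \<open>behavior_approx\<close> applies
    with error 0 and gives equalities.\<close>
  have pick: "AE y in M. \<not> False \<longrightarrow> (\<forall>x\<in>set_pmf (outcome ?s y). snd x = pick (\<lambda>i. z < y i) j L)"
    using AE
  proof eventually_elim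
    case (elim y)
    have "snd x = pick (\<lambda>i. z < y i) j L" if x: "x \<in> set_pmf (outcome ?s y)" for x
    proof -
      from L(1) ne x obtain bs N where bs: "L = bs @ N" "bs \<noteq> []" "x = (bs, best j bs y)"
        "\<forall>i\<in>set (butlast bs). y i \<le> z" "N \<noteq> [] \<Longrightarrow> \<exists>k\<in>set bs. z < y k"
        by (rule list_strategy_outcome) blast
      have split: "bs = butlast bs @ [last bs]" using bs(2) by simp
      show ?thesis
      proof (cases "z < y (last bs)")
        case True
        have "best j bs y = last bs"
        proof (rule ccontr)
          assume "best j bs y \<noteq> last bs"
          then have "best j bs y \<in> set (butlast bs)"
            using best_in[OF bs(2), of j y] by (subst (asm) (2) split) auto
          moreover have "y (last bs) \<le> y (best j bs y)"
            using best_ge[OF bs(2)] bs(2) by simp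
          ultimately show False using bs(4) True by force
        qed
        moreover have "pick (\<lambda>i. z < y i) j L = last bs"
        proof -
          have "L = butlast bs @ last bs # N" using bs(1) split by (metis append.assoc append_Cons append_Nil)
          then show ?thesis using pick_append[of "butlast bs"] bs(4) True by (simp add: not_less)
        qed
        ultimately show ?thesis using bs(3) by simp
      next
        case False
        \<comment> \<open>No value above \<open>z\<close>: the whole list is opened, all its values
          equal \<open>z\<close>, and \<open>best\<close> gives the tie to \<open>j\<close>.\<close>
        have le: "y i \<le> z" if "i \<in> set bs" for i
          using that bs(4) False by (subst (asm) split) auto
        then have L_eq: "L = bs" using bs(1,5) by (cases N) (auto simp: not_less[symmetric])
        have "y i = z" if "i \<in> set bs" for i
          using elim le[OF that] z_less_hi[of i] by (metis not_less)
        then have "best j bs y = j" using L(2) unfolding L_eq by (simp add: best_def)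
        moreover have "pick (\<lambda>i. z < y i) j L = j"
          using pick_append[of L "\<lambda>i. z < y i" j "[]"] le by (simp add: L_eq not_less)
        ultimately show ?thesis using bs(3) by simp
      qed
    qed
    then show ?case by simp
  qed
  have hit: "hit i = 1 - p i" for i using hit_law[OF adm, of i] by (simp add: q_z)
  have approx: "\<bar>chosen p j L k - choice_behavior (law ?\<zeta> ?\<zeta>) ?s $ k\<bar> \<le> 0"
    "hit k * \<bar>opened p L k - search_behavior (law ?\<zeta> ?\<zeta>) ?s $ k\<bar> \<le> 0" for k
    using behavior_approx[OF opt L, of "\<lambda>_. False" 0 k, OF _ _ pick] by (simp_all add: hit)
  have "choice_behavior (law ?\<zeta> ?\<zeta>) ?s $ k = chosen p j L k"
    "search_behavior (law ?\<zeta> ?\<zeta>) ?s $ k = opened p L k" for k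
    using approx[of k] hit_pos[of k] by (auto simp: mult_le_0_iff)
  then have "point p L j = (search_behavior (law ?\<zeta> ?\<zeta>) ?s, choice_behavior (law ?\<zeta> ?\<zeta>) ?s)"
    by (simp add: point_def vec_eq_iff)
  then show ?thesis
    unfolding feasible_pairs_def using feasible_law[OF adm] opt by blast
qed

text \<open>Here \<open>\<zeta>\<close> decreases strictly along \<open>L\<close> and exceeds \<open>w j = z + \<epsilon>\<close> there, while all other low values and
  all other reservation values are at most \<open>z\<close>; so the maximizer of the capped values is unique.\<close>

lemma pick_perturbed:
  assumes L: "distinct L" "j \<in> set L" and \<epsilon>: "0 < \<epsilon>"
    and \<zeta>: "\<And>k. \<zeta> k = z + \<epsilon> * (of_bool (k \<in> set L) + opened (\<lambda>_. 1 / 2) L k)"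
    and w: "\<And>k. w k = z + \<epsilon> * of_bool (k = j)"
    and adm: "admissible \<zeta> w"
    and y: "\<And>i. y i = hi i \<or> y i = w i \<or> y i = lo i" "y j \<noteq> lo j"
    and x: "boxes.weitzman_outcome \<zeta> y x"
  shows "snd x = pick (\<lambda>i. \<zeta> i < y i) j L"
proof -
  interpret boxes "law \<zeta> w" c \<zeta> by (rule boxes_law[OF adm])
  have opened_pos: "0 < opened (\<lambda>_. 1 / 2 :: real) L k" if "k \<in> set L" for k
    using that by (intro opened_bounds) auto
  have cap_out: "cap i y \<le> z" if "i \<notin> set L" for i
    using that \<zeta>[of i] by (simp add: cap_def opened_notin)
  have cap_low: "cap i y \<le> z" if "\<not> \<zeta> i < y i" "i \<noteq> j" for i
    using that y(1)[of i] w[of i] lo_less_z[of i] admD[OF adm, of i] by (auto simp: cap_def min_le_iff_disj)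
  have cap_j: "cap j y = z + \<epsilon>" if "\<not> \<zeta> j < y j"
    using that y(1)[of j] y(2) w[of j] admD[OF adm, of j] by (auto simp: cap_def)
  have max: "cap i y \<le> cap (snd x) y" for i
    using x by (simp add: weitzman_outcome_def)
  show ?thesis
  proof (rule pick_cases[of L "\<lambda>i. \<zeta> i < y i" j])
    assume cold: "\<forall>i\<in>set L. \<not> \<zeta> i < y i" and eq: "pick (\<lambda>i. \<zeta> i < y i) j L = j"
    have "snd x = j"
    proof (rule ccontr)
      assume "snd x \<noteq> j"
      \<comment> \<open>Boxes off \<open>L\<close> are capped at \<open>z\<close> by their
        reservation value, boxes of \<open>L\<close> other than \<open>j\<close> by their low value;
        \<open>j\<close> alone reaches \<open>z + \<epsilon>\<close>.\<close>
      then have "cap (snd x) y \<le> z" using cap_out cap_low cold by blast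
      then show False using max[of j] cap_j cold L(2) \<epsilon> by auto
    qed
    with eq show ?thesis by simp
  next
    fix L1 k L2
    assume split: "L = L1 @ k # L2" and hot: "\<zeta> k < y k" and cold: "\<forall>i\<in>set L1. \<not> \<zeta> i < y i"
      and eq: "pick (\<lambda>i. \<zeta> i < y i) j L = k"
    have k: "k \<in> set L" using split by simp
    have cap_k: "cap k y = \<zeta> k" using hot by (simp add: cap_def)
    have \<zeta>_k: "z + \<epsilon> < \<zeta> k" using opened_pos[OF k] \<epsilon> k by (simp add: \<zeta>)
    have "snd x = k"
    proof (rule ccontr)
      let ?i = "snd x"
      assume ne: "?i \<noteq> k"
      consider "?i \<notin> set L" | "?i \<in> set L1" | "?i \<in> set L2" using ne split by auto
      then have "cap ?i y < \<zeta> k"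
      proof cases
        case 1
        then show ?thesis using cap_out[of ?i] \<zeta>_k \<epsilon> by simp
      next
        case 2
        then show ?thesis using cold cap_low[of ?i] cap_j \<zeta>_k \<epsilon> by (cases "?i = j") auto
      next
        case 3
        \<comment> \<open>A box behind \<open>k\<close> may have any value; its cap stays below
          \<open>\<zeta> k\<close> because \<open>\<zeta>\<close> decreases strictly along
          \<open>L\<close>.\<close>
        have "sorted_wrt (\<lambda>a b. opened (\<lambda>_. 1 / 2 :: real) L b < opened (\<lambda>_. 1 / 2) L a) L"
          by (rule opened_decreasing[OF _ _ L(1)]) auto
        then have "opened (\<lambda>_. 1 / 2 :: real) L ?i < opened (\<lambda>_. 1 / 2) L k"
          using 3 by (subst (asm) (3) split) (auto simp: sorted_wrt_append)
        then have "\<zeta> ?i < \<zeta> k" using 3 k split \<epsilon> by (simp add: \<zeta>)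
        then show ?thesis by (simp add: cap_def)
      qed
      then show False using max[of k] cap_k by simp
    qed
    with eq show ?thesis by simp
  qed
qed

text \<open>As \<epsilon> tends to 0 the perturbed laws converge to the tying laws on {z,
  \<open>hi i\<close>}, while for each \<epsilon> the choice of every optimal strategy is forced
  unless \<open>y j = lo j\<close>.\<close>

lemma fully_implementable_point:
  assumes L: "distinct L" "j \<in> set L"
  shows "fully_implementable lo hi lam c (point p L j)"
proof -
  \<comment> \<open>The summand 1 lifts all of \<open>L\<close> to the level of \<open>w j\<close>;
    the geometric weights put it strictly above and order it.\<close>
  define e where "e k = of_bool (k \<in> set L) + opened (\<lambda>_. 1 / 2 :: real) L k" for k
  define \<zeta> where "\<zeta> \<epsilon> k = z + \<epsilon> * e k" for \<epsilon> k
  define w where "w \<epsilon> k = z + \<epsilon> * of_bool (k = j)" for \<epsilon> k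
  \<comment> \<open>The mass at \<open>lo j\<close>, where the fallback to \<open>j\<close> fails;
    its limit is 1 - (1 - \<open>p j\<close>) - \<open>p j\<close> = 0.\<close>
  define \<eta> where "\<eta> \<epsilon> = 1 - q (\<zeta> \<epsilon>) j - r (\<zeta> \<epsilon>) (w \<epsilon>) j" for \<epsilon>
  have lim_\<zeta>: "((\<lambda>\<epsilon>. \<zeta> \<epsilon> k) \<longlongrightarrow> z) (at_right 0)" for k
    unfolding \<zeta>_def by (auto intro!: tendsto_eq_intros)
  have lim_w: "((\<lambda>\<epsilon>. w \<epsilon> k) \<longlongrightarrow> z) (at_right 0)" for k
    unfolding w_def by (auto intro!: tendsto_eq_intros)
  have lim_q: "((\<lambda>\<epsilon>. q (\<zeta> \<epsilon>) k) \<longlongrightarrow> 1 - p k) (at_right 0)" for k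
    unfolding q_def p_def using lim_\<zeta>[of k] z_less_hi[of k] by (auto intro!: tendsto_eq_intros)
  have lim_r': "((\<lambda>\<epsilon>. r (\<zeta> \<epsilon>) (w \<epsilon>) k) \<longlongrightarrow> (\<mu> k - lo k - (1 - p k) * (hi k - lo k)) / (z - lo k)) (at_right 0)" for k
    unfolding r_def using lo_less_z[of k] by (intro tendsto_intros lim_q lim_w) auto
  have lim_r: "((\<lambda>\<epsilon>. r (\<zeta> \<epsilon>) (w \<epsilon>) k) \<longlongrightarrow> p k) (at_right 0)" for k
  proof -
    have "p k * (z - lo k) / (z - lo k) = p k" using lo_less_z[of k] by simp
    with lim_r'[of k] show ?thesis unfolding mean_z by (simp only:)
  qed
  have lim_\<eta>: "(\<eta> \<longlongrightarrow> 0) (at_right 0)"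
    unfolding \<eta>_def using tendsto_diff[OF tendsto_diff[OF tendsto_const[of 1] lim_q[of j]] lim_r[of j]] by simp
  have w_le_\<zeta>: "z \<le> w \<epsilon> k" "w \<epsilon> k \<le> \<zeta> \<epsilon> k" if "0 < \<epsilon>" for \<epsilon> k
  proof -
    have "0 \<le> opened (\<lambda>_. 1 / 2 :: real) L k"
      using opened_bounds(1)[of "\<lambda>_. 1 / 2 :: real" k L] opened_notin[of k L "\<lambda>_. 1 / 2"] by (cases "k \<in> set L") auto
    then have "of_bool (k = j) \<le> e k" using L(2) by (auto simp: e_def)
    then show "z \<le> w \<epsilon> k" "w \<epsilon> k \<le> \<zeta> \<epsilon> k" using that by (auto simp: w_def \<zeta>_def)
  qed
  have "\<forall>\<^sub>F \<epsilon> in at_right 0. \<zeta> \<epsilon> k < hi k" for k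
    using order_tendstoD(2)[OF lim_\<zeta> z_less_hi] .
  moreover have "\<forall>\<^sub>F \<epsilon> in at_right 0. q (\<zeta> \<epsilon>) k * (hi k - lo k) < \<mu> k - lo k" for k
  proof -
    have "0 < p k * (z - lo k)" using p_bounds(1)[of k] lo_less_z[of k] by simp
    then have "(1 - p k) * (hi k - lo k) < \<mu> k - lo k" using mean_z[of k] by linarith
    then show ?thesis by (rule order_tendstoD(2)[OF tendsto_mult[OF lim_q tendsto_const]])
  qed
  ultimately have "\<forall>\<^sub>F \<epsilon> in at_right 0. \<forall>k\<in>UNIV. \<zeta> \<epsilon> k < hi k \<and> q (\<zeta> \<epsilon>) k * (hi k - lo k) < \<mu> k - lo k"
    by (intro eventually_ball_finite) (auto intro: eventually_conj)
  then have ev_adm: "\<forall>\<^sub>F \<epsilon> in at_right 0. admissible (\<zeta> \<epsilon>) (w \<epsilon>)"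
    using eventually_at_right_less[of 0]
    by eventually_elim (use w_le_\<zeta> in \<open>auto simp: admissible_def intro: less_imp_le\<close>)
  have lim_p: "((\<lambda>\<epsilon>. 1 - q (\<zeta> \<epsilon>) k) \<longlongrightarrow> p k) (at_right 0)" for k
    using tendsto_diff[OF tendsto_const[of 1] lim_q[of k]] by simp
  have err_d: "((\<lambda>\<epsilon>. \<bar>chosen p j L k - chosen (\<lambda>i. 1 - q (\<zeta> \<epsilon>) i) j L k\<bar> + \<eta> \<epsilon>) \<longlongrightarrow> 0) (at_right 0)" for k
    using tendsto_add[OF tendsto_rabs[OF tendsto_diff[OF tendsto_const[of "chosen p j L k"] tendsto_chosen[where j = j and L = L and k = k and f = "\<lambda>\<epsilon> i. 1 - q (\<zeta> \<epsilon>) i" and p = p, OF lim_p]]] lim_\<eta>]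
    by simp
  \<comment> \<open>\<open>behavior_approx\<close> bounds the search error only after multiplication
    by \<open>hit\<close>, which is \<open>q\<close> here; dividing is harmless because
    \<open>q\<close> tends to \<open>1 - p k\<close>, which is positive.\<close>
  have err_v: "((\<lambda>\<epsilon>. \<bar>opened p L k - opened (\<lambda>i. 1 - q (\<zeta> \<epsilon>) i) L k\<bar> + \<eta> \<epsilon> / q (\<zeta> \<epsilon>) k) \<longlongrightarrow> 0) (at_right 0)" for k
  proof -
    have "1 - p k \<noteq> 0" using p_bounds(2)[of k] by simp
    from tendsto_add[OF tendsto_rabs[OF tendsto_diff[OF tendsto_const[of "opened p L k"] tendsto_opened[where L = L and k = k and f = "\<lambda>\<epsilon> i. 1 - q (\<zeta> \<epsilon>) i" and p = p, OF lim_p]]]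
        tendsto_divide[OF lim_\<eta> lim_q this]]
    show ?thesis by simp
  qed
  have "\<exists>F. feasible_profile lo hi lam F \<and> (\<forall>s. optimal c F s \<longrightarrow>
      (\<forall>i. \<bar>opened p L i - search_behavior F s $ i\<bar> < \<delta>) \<and> (\<forall>i. \<bar>chosen p j L i - choice_behavior F s $ i\<bar> < \<delta>))"
    if \<delta>: "0 < \<delta>" for \<delta>
  proof -
    have "\<forall>\<^sub>F \<epsilon> in at_right 0. \<forall>k\<in>UNIV.
        \<bar>chosen p j L k - chosen (\<lambda>i. 1 - q (\<zeta> \<epsilon>) i) j L k\<bar> + \<eta> \<epsilon> < \<delta> \<and>
        \<bar>opened p L k - opened (\<lambda>i. 1 - q (\<zeta> \<epsilon>) i) L k\<bar> + \<eta> \<epsilon> / q (\<zeta> \<epsilon>) k < \<delta>"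
      using order_tendstoD(2)[OF err_d \<delta>] order_tendstoD(2)[OF err_v \<delta>]
      by (intro eventually_ball_finite) (auto intro: eventually_conj)
    then have "\<forall>\<^sub>F \<epsilon> in at_right 0. 0 < \<epsilon> \<and> admissible (\<zeta> \<epsilon>) (w \<epsilon>) \<and> (\<forall>k.
        \<bar>chosen p j L k - chosen (\<lambda>i. 1 - q (\<zeta> \<epsilon>) i) j L k\<bar> + \<eta> \<epsilon> < \<delta> \<and>
        \<bar>opened p L k - opened (\<lambda>i. 1 - q (\<zeta> \<epsilon>) i) L k\<bar> + \<eta> \<epsilon> / q (\<zeta> \<epsilon>) k < \<delta>)"
      using ev_adm eventually_at_right_less[of 0] by eventually_elim auto
    then obtain \<epsilon> where \<epsilon>: "0 < \<epsilon>" and adm: "admissible (\<zeta> \<epsilon>) (w \<epsilon>)" and close: "\<And>k.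
        \<bar>chosen p j L k - chosen (\<lambda>i. 1 - q (\<zeta> \<epsilon>) i) j L k\<bar> + \<eta> \<epsilon> < \<delta>" "\<And>k.
        \<bar>opened p L k - opened (\<lambda>i. 1 - q (\<zeta> \<epsilon>) i) L k\<bar> + \<eta> \<epsilon> / q (\<zeta> \<epsilon>) k < \<delta>"
      using eventually_happens'[OF trivial_limit_at_right_real] by blast
    let ?F = "law (\<zeta> \<epsilon>) (w \<epsilon>)"
    interpret boxes ?F c "\<zeta> \<epsilon>" by (rule boxes_law[OF adm])
    have AE: "AE y in M. \<forall>i. y i = hi i \<or> y i = w \<epsilon> i \<or> y i = lo i"
      by (rule AE_all_components, rule AE_law[OF adm]) auto
    have bad: "(\<integral>y. of_bool (y j = lo j) \<partial>M) = \<eta> \<epsilon>"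
    proof -
      have "integrable (?F j) (\<lambda>t. of_bool (t = lo j) :: real)"
        by (rule M.integrable_const_bound[where B = 1]) (auto simp: sets_F cong: measurable_cong_sets)
      from integral_mult_component(2)[of "\<lambda>_. 1" 1 j, OF _ _ _ this]
      have "(\<integral>y. of_bool (y j = lo j) \<partial>M) = (\<integral>t. (of_bool (t = lo j) :: real) \<partial>?F j)"
        by (simp add: P.prob_space)
      also have "\<dots> = \<eta> \<epsilon>"
        using admD[OF adm, of j] lo_less_hi[of j] by (subst integral_law[OF adm]) (auto simp: \<eta>_def)
      finally show ?thesis .
    qed
    have "\<bar>opened p L k - search_behavior ?F s $ k\<bar> < \<delta> \<and> \<bar>chosen p j L k - choice_behavior ?F s $ k\<bar> < \<delta>"
      if s: "optimal c ?F s" for s k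
    proof -
      have "AE y in M. \<forall>x\<in>set_pmf (outcome s y). weitzman_outcome y x"
        using s by (simp add: optimal_iff)
      then have pick: "AE y in M. \<not> y j = lo j \<longrightarrow>
          (\<forall>x\<in>set_pmf (outcome s y). snd x = pick (\<lambda>i. \<zeta> \<epsilon> i < y i) j L)"
        using AE
      proof eventually_elim
        case (elim y)
        show ?case
          by (intro impI ballI pick_perturbed[OF L \<epsilon> _ _ adm])
             (use elim in \<open>auto simp: \<zeta>_def w_def e_def\<close>)
      qed
      have hit: "hit i = q (\<zeta> \<epsilon>) i" for i by (rule hit_law[OF adm])
      have "\<bar>chosen (\<lambda>i. 1 - q (\<zeta> \<epsilon>) i) j L k - choice_behavior ?F s $ k\<bar> \<le> \<eta> \<epsilon>"
        "q (\<zeta> \<epsilon>) k * \<bar>opened (\<lambda>i. 1 - q (\<zeta> \<epsilon>) i) L k - search_behavior ?F s $ k\<bar> \<le> \<eta> \<epsilon>"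
        using behavior_approx[OF s L _ _ pick, of "\<eta> \<epsilon>" k] bad by (auto simp: hit)
      moreover from this(2) have "\<bar>opened (\<lambda>i. 1 - q (\<zeta> \<epsilon>) i) L k - search_behavior ?F s $ k\<bar> \<le> \<eta> \<epsilon> / q (\<zeta> \<epsilon>) k"
        using hit_pos[of k] by (simp add: hit pos_le_divide_eq mult.commute)
      ultimately show ?thesis using close[of k] by linarith
    qed
    then show ?thesis using feasible_law[OF adm] by blast
  qed
  then show ?thesis by (simp add: fully_implementable_def point_def)
qed

end

section \<open>Exposed points\<close>

context
  fixes h w :: "'n \<Rightarrow> real"
  assumes h: "\<And>i. 0 < h i" "\<And>i. h i < 1"
begin

lemma walk_nonpos: "\<forall>k\<in>set L. w k < 0 \<Longrightarrow> e \<le> 0 \<Longrightarrow> walk w e h L \<le> 0"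
proof (induction L)
  case (Cons x L)
  then have "h x * w x \<le> 0" "(1 - h x) * walk w e h L \<le> 0"
    using h[of x] by (auto simp: mult_le_0_iff)
  then show ?case by simp
qed simp

lemma walk_neg:
  assumes "L \<noteq> []" "\<forall>k\<in>set L. w k < 0" "e \<le> 0"
  shows "walk w e h L < 0"
proof (cases L)
  case (Cons x M)
  have "h x * w x < 0" using assms(2) Cons h(1)[of x] by (simp add: mult_less_0_iff)
  moreover have "(1 - h x) * walk w e h M \<le> 0"
    using walk_nonpos[of M e] assms Cons h(2)[of x] by (simp add: mult_le_0_iff)
  ultimately show ?thesis using Cons by simp
qed (use assms in simp)

lemma walk_less: "\<forall>k\<in>set L. w k < u \<Longrightarrow> e < u \<Longrightarrow> walk w e h L < u"
proof (induction L)
  case (Cons x L)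
  then have "h x * w x < h x * u" "(1 - h x) * walk w e h L < (1 - h x) * u"
    using h[of x] by auto
  then have "walk w e h (x # L) < h x * u + (1 - h x) * u" by simp
  then show ?case by (simp add: algebra_simps)
qed simp

text \<open>Exchange argument: moving \<open>x\<close> ahead of its neighbor \<open>a\<close>
  changes the walk by \<open>h x * h a * (w x - w a)\<close>.\<close>

lemma walk_to_front:
  "A \<noteq> [] \<Longrightarrow> \<forall>k\<in>set A. w k < w x \<Longrightarrow> walk w e h (A @ x # B) < walk w e h (x # A @ B)"
proof (induction A)
  case (Cons a A)
  let ?W = "walk w e h (A @ B)"
  have "walk w e h (A @ x # B) \<le> walk w e h (x # A @ B)"
    using Cons by (cases "A = []") auto
  then have "(1 - h a) * walk w e h (A @ x # B) \<le> (1 - h a) * walk w e h (x # A @ B)"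
    using h[of a] by (intro mult_left_mono) auto
  then have "walk w e h ((a # A) @ x # B) \<le> h a * w a + (1 - h a) * (h x * w x + (1 - h x) * ?W)"
    by simp
  also have "\<dots> < h x * w x + (1 - h x) * (h a * w a + (1 - h a) * ?W)"
  proof -
    have "0 < h x * h a * (w x - w a)" using h[of x] h[of a] Cons.prems(2) by simp
    then show ?thesis by (simp add: algebra_simps)
  qed
  finally show ?case by simp
qed simp

text \<open>The head \<open>x\<close> of \<open>L\<close> has the largest weight. A list without
  \<open>x\<close> yields at most the walk of the tail of \<open>L\<close>, which \<open>x\<close>
  in front improves; a list with \<open>x\<close> further back improves when \<open>x\<close> moves
  to the front. The tails are compared by induction.\<close>

lemma walk_unique_max:
  "sorted_wrt (\<lambda>a b. w b < w a) L \<Longrightarrow> \<forall>k\<in>set L. 0 < w k \<Longrightarrow> distinct L' \<Longrightarrow>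
    \<forall>k\<in>set L' - set L. w k < 0 \<Longrightarrow> e \<le> 0 \<Longrightarrow> (L', e) \<noteq> (L, 0) \<Longrightarrow>
    walk w e h L' < walk w 0 h L"
proof (induction L arbitrary: L' e)
  case Nil
  then show ?case by (cases "L' = []") (auto intro!: walk_neg)
next
  case (Cons x L)
  have less: "w k < w x" if "k \<in> set L" for k using Cons.prems(1) that by simp
  have wx: "0 < w x" using Cons.prems(2) by simp
  have IH: "walk w e h M \<le> walk w 0 h L"
    if "distinct M" "x \<notin> set M" "set M \<subseteq> set L'" for M
    using Cons.IH[of M e] Cons.prems that by (cases "(M, e) = (L, 0)") (auto intro: less_imp_le)
  show ?case
  proof (cases "x \<in> set L'")
    case False
    have "walk w 0 h L < w x" using less wx by (intro walk_less) auto
    then have "h x * walk w 0 h L < h x * w x" using h[of x] by simp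
    then have "walk w 0 h L < walk w 0 h (x # L)" by (simp add: algebra_simps)
    with IH[of L'] False Cons.prems(3) show ?thesis by simp
  next
    case True
    then obtain A B where AB: "L' = A @ x # B" by (auto dest: split_list)
    show ?thesis
    proof (cases "A = []")
      case True
      then have "walk w e h B < walk w 0 h L"
        using Cons.prems AB by (intro Cons.IH) auto
      then show ?thesis using True AB h[of x] by simp
    next
      case False
      have "w k < w x" if "k \<in> set A" for k
      proof (cases "k \<in> set L")
        case False
        then have "w k < 0" using that Cons.prems(3,4) AB by auto
        then show ?thesis using wx by simp
      qed (rule less)
      then have "walk w e h L' < walk w e h (x # A @ B)"
        unfolding AB using False by (intro walk_to_front) auto
      also have "\<dots> \<le> walk w 0 h (x # L)"
        using IH[of "A @ B"] Cons.prems(3) AB h[of x] by auto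
      finally show ?thesis .
    qed
  qed
qed

end

text \<open>The exposing functional pays \<open>r k\<close> for being forced to stop at box \<open>k\<close>, decreasing along \<open>L\<close> and
  negative off \<open>L\<close>, and \<open>b k\<close> for choosing \<open>k\<close> after no forced stop.\<close>

lemma point_exposed:
  fixes p :: "'n::finite \<Rightarrow> real"
  assumes p: "\<And>i. 0 < p i" "\<And>i. p i < 1" and L: "distinct L"
  obtains f :: "(real^'n) \<times> (real^'n) \<Rightarrow> real" where "linear f"
    "\<And>t. t \<in> points p \<Longrightarrow> t \<noteq> point p L j \<Longrightarrow> f t < f (point p L j)"
proof -
  define r where "r k = opened (\<lambda>_. 1 / 2 :: real) L k - of_bool (k \<notin> set L)" for k
  define b where "b k = (if k = j then 0 else - 1 :: real)" for k
  \<comment> \<open>Solves \<open>a k + (1 - p k) * b k = (1 - p k) * r k\<close>: a stop at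
    \<open>k\<close> then pays \<open>r k\<close>, and \<open>val\<close> becomes a
    \<open>walk\<close> ending in \<open>b j\<close>.\<close>
  define a where "a k = (1 - p k) * (r k - b k)" for k
  define f where "f = inner ((\<chi> k. a k) :: real^'n, (\<chi> k. b k) :: real^'n)"
  have val: "val p a b j' L' = walk r (b j') (\<lambda>i. 1 - p i) L'" for j' L'
    by (induction L') (simp_all add: a_def algebra_simps)
  have f: "f (point p L' j') = walk r (b j') (\<lambda>i. 1 - p i) L'" if "distinct L'" for L' j'
    unfolding val[symmetric] val_eq[OF that] by (simp add: f_def point_def inner_vec_def)
  have sorted: "sorted_wrt (\<lambda>k l. r l < r k) L"
    by (rule sorted_wrt_mono_rel[OF _ opened_decreasing[of "\<lambda>_. 1 / 2", OF _ _ L]])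
       (simp_all add: r_def)
  have pos: "\<forall>k\<in>set L. 0 < r k"
    by (simp add: r_def opened_bounds(1)[of "\<lambda>_. 1 / 2 :: real"])
  have neg: "\<forall>k\<in>set L' - set L. r k < 0" for L'
    by (simp add: r_def opened_notin)
  show thesis
  proof (rule that)
    show "linear f" unfolding f_def by (rule bounded_linear.linear[OF bounded_linear_inner_right])
    fix t assume t: "t \<in> points p" "t \<noteq> point p L j"
    then obtain L' j' where L': "t = point p L' j'" "distinct L'" by (auto simp: points_def)
    \<comment> \<open>\<open>b\<close> vanishes only at \<open>j\<close>, so list and final payment
      together determine the point.\<close>
    have ne: "(L', b j') \<noteq> (L, 0)" using t(2) L'(1) by (auto simp: b_def split: if_splits)
    show "f t < f (point p L j)"
      unfolding L'(1) f[OF L'(2)] f[OF L]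
      using walk_unique_max[OF _ _ sorted pos L'(2) neg _ ne] p by (simp add: b_def)
  qed
qed

section \<open>Vertices of a set between finitely many points and their hull\<close>

lemma linear_less_on_hull:
  fixes f :: "'a::real_vector \<Rightarrow> real"
  assumes f: "linear f" and less: "\<And>x. x \<in> A \<Longrightarrow> f x < u" and x: "x \<in> convex hull A"
  shows "f x < u"
proof -
  have "convex (f -` {..<u})" by (rule convex_linear_vimage[OF f]) simp
  then have "convex hull A \<subseteq> f -` {..<u}" using less by (intro hull_minimal) auto
  then show ?thesis using x by auto
qed

text \<open>If the vertex were not a generator, its functional would be strictly smaller on all
  generators, hence on the hull, which contains the vertex.\<close>

lemma vertex_in_generators:
  fixes t :: "'a::real_vector"
  assumes "vertex_of t S" "S \<subseteq> convex hull A" "A \<subseteq> S"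
  shows "t \<in> A"
proof (rule ccontr)
  assume "t \<notin> A"
  obtain f :: "'a \<Rightarrow> real" where f: "linear f" "\<And>x. x \<in> S \<Longrightarrow> x \<noteq> t \<Longrightarrow> f x < f t" and t: "t \<in> S"
    using assms(1) unfolding vertex_of_def by blast
  have "f t < f t"
    by (rule linear_less_on_hull[OF f(1), of A]) (use f t assms \<open>t \<notin> A\<close> in auto)
  then show False by simp
qed

text \<open>Strictness does not pass to the hull directly, as \<open>t\<close> may be a generator.
  Any other point of the hull gives positive weight to the hull of the remaining generators, where
  the functional is strictly smaller.\<close>

lemma vertex_of_subset_hull:
  fixes f :: "'a::real_vector \<Rightarrow> real"
  assumes f: "linear f" "\<And>x. x \<in> A \<Longrightarrow> x \<noteq> t \<Longrightarrow> f x < f t"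
    and S: "S \<subseteq> convex hull A" "t \<in> S"
  shows "vertex_of t S"
  unfolding vertex_of_def
proof (intro conjI exI ballI impI)
  fix u assume u: "u \<in> S" "u \<noteq> t"
  have "A \<subseteq> insert t (A - {t})" by auto
  then have hull: "u \<in> convex hull (insert t (A - {t}))" using hull_mono S(1) u(1) by blast
  show "f u < f t"
  proof (cases "A - {t} = {}")
    case True
    with hull u(2) show ?thesis by simp
  next
    case False
    from hull obtain x y v where v: "0 \<le> x" "0 \<le> y" "x + y = 1" "v \<in> convex hull (A - {t})"
      "u = x *\<^sub>R t + y *\<^sub>R v"
      unfolding convex_hull_insert[OF False] by blast
    have fv: "f v < f t" by (rule linear_less_on_hull[OF f(1) _ v(4)]) (use f(2) in auto)
    have "y \<noteq> 0" using v u(2) by auto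
    then have "y * f v < y * f t" using fv v(2) by simp
    moreover have "f u = x * f t + y * f v" using f(1) v(5) by (simp add: linear_add linear_scale)
    moreover have "x * f t + y * f t = f t" using v(3) by (metis distrib_right mult_1)
    ultimately show ?thesis by linarith
  qed
qed (use f S in auto)

section \<open>Closed formulas for the candidate vertices\<close>

lemma opened_sorted:
  "sorted_wrt (<) L \<Longrightarrow> opened p L k = (if k \<in> set L then \<Prod>l | l \<in> set L \<and> l < k. p l else 0)"
  for L :: "'n::linorder list"
proof (induction L)
  case (Cons x L)
  consider "k = x" | "k \<noteq> x" "k \<notin> set L" | "k \<noteq> x" "k \<in> set L" by blast
  then show ?case
  proof cases
    case 1
    have empty: "{l. l \<in> set (x # L) \<and> l < x} = {}" using Cons.prems by auto
    show ?thesis unfolding 1 empty by simp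
  next
    case 2
    then show ?thesis by (simp add: opened_notin)
  next
    case 3
    then have "{l \<in> set (x # L). l < k} = insert x {l \<in> set L. l < k}" using Cons.prems by auto
    moreover have "x \<notin> set L" using Cons.prems by auto
    ultimately show ?thesis using 3 Cons by simp
  qed
qed simp

text \<open>Forced stops at \<open>k\<close>, plus the probability that no box of \<open>L\<close>
  forces a stop, which goes to \<open>j\<close>.\<close>

lemma chosen_eq: "distinct L \<Longrightarrow> chosen p j L k = (1 - p k) * opened p L k + of_bool (k = j) * (\<Prod>l\<in>set L. p l)"
proof (induction L)
  case (Cons x L)
  then have "chosen p j (x # L) k = (1 - p x) * of_bool (k = x) +
      p x * ((1 - p k) * opened p L k + of_bool (k = j) * (\<Prod>l\<in>set L. p l))"
    by simp
  then show ?case using Cons.prems by (auto simp: opened_notin algebra_simps)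
qed simp

text \<open>For the ascending list of \<open>{..i}\<close> the predecessors of \<open>k\<close> in
  \<open>L\<close> are all smaller boxes, which gives \<open>v_bar\<close>; the mass left after the
  last box is the product over \<open>{..i}\<close>, that is \<open>p i * v_bar p i\<close>.\<close>

lemma eq_point_iff:
  fixes p :: "'n::{finite,linorder} \<Rightarrow> real"
  assumes L: "sorted_wrt (<) L" "set L = {..i}" and j: "j \<le> i"
  shows "(v, d) = point p L j \<longleftrightarrow>
    (\<forall>k. v $ k = (if k \<le> i then v_bar p k else 0) \<and>
         d $ k = (if k \<le> i \<and> k \<noteq> j then v_bar p k - v_bar_next p k
                  else if k = j then v_bar p k - v_bar_next p k + p i * v_bar p i
                  else 0))"
proof -
  have next_eq: "v_bar_next p k = p k * v_bar p k" for k
  proof -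
    have "{..k} = insert k {..<k}" by auto
    then show ?thesis by (simp add: v_bar_next_def v_bar_def)
  qed
  have opened: "opened p L k = (if k \<le> i then v_bar p k else 0)" for k
  proof -
    have "{l. l \<le> i \<and> l < k} = {..<k}" if "k \<le> i" using that by auto
    then show ?thesis by (simp add: opened_sorted[OF L(1)] L(2) v_bar_def)
  qed
  have "(\<Prod>l\<in>set L. p l) = p i * v_bar p i"
    unfolding L(2) next_eq[symmetric] v_bar_next_def ..
  moreover have "distinct L" using L(1) strict_sorted_iff by blast
  ultimately have "chosen p j L k = (if k \<le> i \<and> k \<noteq> j then v_bar p k - v_bar_next p k
                  else if k = j then v_bar p k - v_bar_next p k + p i * v_bar p i
                  else 0)" for k
    using j by (simp add: chosen_eq opened next_eq algebra_simps)
  with opened show ?thesis by (auto simp: point_def vec_eq_iff)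
qed

text \<open>\<open>opened\<close> decreases strictly along \<open>L\<close>, so monotonicity in the
  index makes \<open>L\<close> ascending; it is positive on \<open>L\<close> and zero off it, so no
  box below the largest one of \<open>L\<close> is missing.\<close>

lemma point_antimono:
  fixes p :: "'n::{finite,linorder} \<Rightarrow> real"
  assumes p: "\<And>i. 0 < p i" "\<And>i. p i < 1" and L: "distinct L" "L \<noteq> []"
    and anti: "\<And>k l. k \<le> l \<Longrightarrow> opened p L l \<le> opened p L k"
  obtains i where "sorted_wrt (<) L" "set L = {..i}"
proof
  show "sorted_wrt (<) L"
    by (rule sorted_wrt_mono_rel[OF _ opened_decreasing[OF p L(1)]]) (use anti in \<open>force simp: not_le[symmetric]\<close>)
  have Max: "Max (set L) \<in> set L" using L(2) by (intro Max_in) auto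
  have "k \<in> set L" if "k \<le> Max (set L)" for k
  proof (rule ccontr)
    assume "k \<notin> set L"
    then show False
      using anti[OF that] opened_bounds(1)[where p = p, OF p Max] by (simp add: opened_notin)
  qed
  then show "set L = {..Max (set L)}" by auto
qed

theorem proposition5:
  fixes lo hi lam c :: "'n::{finite,linorder} \<Rightarrow> real"
  assumes "CARD('n) \<ge> 2"
    and "\<And>i. 0 \<le> lo i" and "\<And>i. lo i < hi i" and "\<And>i. hi i \<le> 1"
    and "\<And>i. 0 < lam i" and "\<And>i. lam i < 1"
    and "\<And>i. 0 < c i" and "\<And>i. c i < lam i * (hi i - lo i)"
    and "\<And>i. z_low lo hi lam c i = z_max lo hi lam c"
  shows "let S = feasible_pairs lo hi lam c; p = p_cont lo hi lam c in
           (\<forall>v d. (v, d) \<in> S \<longrightarrow> (\<forall>k l. k \<le> l \<longrightarrow> v $ l \<le> v $ k) \<longrightarrow>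
               (vertex_of (v, d) S \<longleftrightarrow>
                 (\<exists>i j. j \<le> i \<and>
                   (\<forall>k. v $ k = (if k \<le> i then v_bar p k else 0) \<and>
                        d $ k = (if k \<le> i \<and> k \<noteq> j then v_bar p k - v_bar_next p k
                                 else if k = j then v_bar p k - v_bar_next p k + p i * v_bar p i
                                 else 0))))) \<and>
            (\<forall>v d. vertex_of (v, d) S \<longrightarrow> fully_implementable lo hi lam c (v, d))"
proof -
  interpret box_problem lo hi lam c "z_max lo hi lam c"
    by unfold_locales (use assms in \<open>auto simp: z_low_def\<close>)
  have p_eq: "p_cont lo hi lam c = p"
    by (auto simp: p_cont_def p_def)
  let ?S = "feasible_pairs lo hi lam c"
  have points_subset: "points p \<subseteq> ?S"
    unfolding points_def using point_in_feasible_pairs by blast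
  have vertex_points: "vertex_of t ?S \<Longrightarrow> t \<in> points p" for t
    by (rule vertex_in_generators[OF _ feasible_pairs_subset_hull points_subset])
  have vertex_iff: "vertex_of (v, d) ?S \<longleftrightarrow> (\<exists>i j. j \<le> i \<and>
      (\<forall>k. v $ k = (if k \<le> i then v_bar p k else 0) \<and>
           d $ k = (if k \<le> i \<and> k \<noteq> j then v_bar p k - v_bar_next p k
                    else if k = j then v_bar p k - v_bar_next p k + p i * v_bar p i
                    else 0)))" (is "_ \<longleftrightarrow> (\<exists>i j. j \<le> i \<and> ?form i j)")
    if anti: "\<And>k l. k \<le> l \<Longrightarrow> v $ l \<le> v $ k" for v d
  proof
    assume "vertex_of (v, d) ?S"
    then obtain L j where L: "(v, d) = point p L j" "distinct L" "L \<noteq> []" "j \<in> set L"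
      using vertex_points unfolding points_def by blast
    have "opened p L k = v $ k" for k using L(1) by (simp add: point_def)
    then have anti': "opened p L l \<le> opened p L k" if "k \<le> l" for k l using anti[OF that] by simp
    obtain i where i: "sorted_wrt (<) L" "set L = {..i}"
      using p_bounds L(2,3) anti' by (rule point_antimono)
    have "j \<le> i" using L(4) i(2) by simp
    moreover have "?form i j" using eq_point_iff[OF i \<open>j \<le> i\<close>, of v d p] L(1) by (rule iffD1)
    ultimately show "\<exists>i j. j \<le> i \<and> ?form i j" by blast
  next
    assume "\<exists>i j. j \<le> i \<and> ?form i j"
    then obtain i j where ij: "j \<le> i" "?form i j" by blast
    define L where "L = sorted_list_of_set {..i}"
    have L: "sorted_wrt (<) L" "set L = {..i}" "distinct L" by (simp_all add: L_def)
    have point: "(v, d) = point p L j" using eq_point_iff[OF L(1,2) ij(1), of v d p] ij(2) by (rule iffD2)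
    obtain f :: "_ \<Rightarrow> real" where "linear f" "\<And>t. t \<in> points p \<Longrightarrow> t \<noteq> point p L j \<Longrightarrow> f t < f (point p L j)"
      by (rule point_exposed[where p = p and j = j, OF p_bounds L(3)]) blast
    moreover have "point p L j \<in> ?S"
      using L(2,3) ij(1) by (intro point_in_feasible_pairs) auto
    ultimately show "vertex_of (v, d) ?S"
      unfolding point using feasible_pairs_subset_hull by (intro vertex_of_subset_hull)
  qed
  have implementable: "fully_implementable lo hi lam c t" if vertex: "vertex_of t ?S" for t
  proof -
    obtain L j where "t = point p L j" "distinct L" "j \<in> set L"
      using vertex_points[OF vertex] unfolding points_def by blast
    then show ?thesis using fully_implementable_point by simp
  qed
  show ?thesis unfolding Let_def p_eq
  proof (intro conjI allI impI)
    fix v d :: "(real, 'n) vec" assume "\<forall>k l. k \<le> l \<longrightarrow> v $ l \<le> v $ k"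
    then show "vertex_of (v, d) ?S \<longleftrightarrow> (\<exists>i j. j \<le> i \<and>
      (\<forall>k. v $ k = (if k \<le> i then v_bar p k else 0) \<and>
           d $ k = (if k \<le> i \<and> k \<noteq> j then v_bar p k - v_bar_next p k
                    else if k = j then v_bar p k - v_bar_next p k + p i * v_bar p i
                    else 0)))"
      by (intro vertex_iff) simp
  next
    fix v d :: "(real, 'n) vec" assume "vertex_of (v, d) ?S"
    then show "fully_implementable lo hi lam c (v, d)" by (rule implementable)
  qed
qed

end
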